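(* Consider a $4$-dimensional toric generalized K\"ahler structure $(G,\mathcal J)$ on $M$, determined by a matrix valued function $\Psi=\mathrm{Hess}(\tau)+C$ with $C_{12}\neq0$ (see context), such that $\frac{\partial}{\partial\mu^{2}}\left(\frac{(\Psi_{12})^{s}}{\Psi_{22}}\right)=0$. Let $h=h(\mu^{1})$ be any smooth non-vanishing function with $h'$ non-vanishing and $\lambda_{0},k_{0}\in\mathbb{R}\setminus\{0\}$, such that $\frac{\lambda_{0}h^{3}}{k_{0}h'}$ is (at any point) negative and different from $-2$. Choose $$X_{0}:=-\frac{\partial}{\partial t^{1}},\qquad a:=k_{0}h^{-2},\qquad f^{2}:=-\frac{\lambda_{0}h^{3}}{2k_{0}h'},$$ and $$F:=\frac{2ah'}{h}d\mu^{1}\wedge dt^{1}+\left(\frac{(\Psi_{12})^{s}}{\Psi_{22}}\Big(\lambda_{0}-\frac{2ah'}{h}\Big)d\mu^{1}+\lambda_{0}\,d\mu^{2}\right)\wedge dt^{2}.$$ Then $F$ is closed and $X_{0}$-invariant, $da=-i_{X_{0}}F$, and all the conditions (KK1)--(KK5) stated in the context are satisfied.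
   Context: Generalized geometry. $\mathbb{T}M=TM\oplus T^{*}M$ with projections $\mathrm{pr}_{T},\mathrm{pr}_{T^{*}}$, and $\langle X+\xi,Y+\eta\rangle=\frac12(\eta(X)+\xi(Y))$; everything is extended complex (bi)linearly to $(\mathbb{T}M)^{\mathbb{C}}$. For a pair $(G,\mathcal J)$ of a positive definite metric $G$ on $\mathbb{T}M$ and a $G$-orthogonal, $\langle\cdot,\cdot\rangle$-skew $\mathcal J\in\Gamma\,\mathrm{End}(\mathbb{T}M)$ with $\mathcal J^{2}=-\mathrm{Id}$, $G^{\mathrm{end}}$ is defined by $G(u,v)=\langle G^{\mathrm{end}}u,v\rangle$ (with $(G^{\mathrm{end}})^{2}=\mathrm{Id}$); $\mathcal J_{1}=\mathcal J$, $\mathcal J_{2}=G^{\mathrm{end}}\mathcal J$, $\mathcal J_{3}=\mathcal J_{1}\mathcal J_{2}=-G^{\mathrm{end}}$. $L_{i}$ is the $i$-eigenbundle ($(1,0)$-bundle) of $\mathcal J_{i}$ in $(\mathbb{T}M)^{\mathbb{C}}$ ($i=1,2$), $E_{i}=\mathrm{pr}_{T}(L_{i})$ and $\epsilon_{i}\in\Gamma(\Lambda^{2}E_{i}^{*})$ is determined by $L_{i}=\{X+\xi\in E_{i}\oplus(T^{*}M)^{\mathbb{C}}:\xi|_{E_{i}}=i_{X}\epsilon_{i}\}$. Toric (diagonal) generalized K\"ahler structures in dimension four. $M$ is a connected $4$-manifold with coordinates $(t^{1},t^{2},\mu^{1},\mu^{2})$; $\tau(\mu^{1},\mu^{2})$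 is smooth with positive definite Hessian, $C$ is a constant real skew-symmetric $2\times2$ matrix and $\Psi_{ij}=\frac{\partial^{2}\tau}{\partial\mu^{i}\partial\mu^{j}}+C_{ij}$, with inverse $(\Psi^{ij})$. $(\Psi_{12})^{s}=\frac12(\Psi_{12}+\Psi_{21})$ is the symmetric part. A prime denotes $d/d\mu^{1}$. Put $\omega=\sum_{i}d\mu^{i}\wedge dt^{i}$, $$J_{+}=\sum_{i,j}\Psi_{ij}\frac{\partial}{\partial t^{i}}\otimes d\mu^{j}-\sum_{i,j}\Psi^{ij}\frac{\partial}{\partial\mu^{i}}\otimes dt^{j},\qquad J_{-}=\sum_{i,j}\Psi_{ji}\frac{\partial}{\partial t^{i}}\otimes d\mu^{j}-\sum_{i,j}\Psi^{ji}\frac{\partial}{\partial\mu^{i}}\otimes dt^{j},$$ and, with $\omega:TM\to T^{*}M$, $X\mapsto i_{X}\omega$, $g=-\frac12\omega\circ(J_{+}+J_{-})$ (a Riemannian metric), $b=-\frac12\omega\circ(J_{+}-J_{-})$ (a $2$-form), viewed as maps $TM\to T^{*}M$. The structure $(G,\mathcal J)$ is: $G^{\mathrm{end}}=\pm\mathrm{Id}$ on $C_{\pm}=\{X+(b\pm g)(X)\}$ and $\mathcal J(X+(b\pm g)X)=J_{\pm}X+(b\pm g)J_{\pm}X$. It is generalized K\"ahler with $\mathcal J_{2}(X+\xi)=-\omega^{-1}(\xi)+i_{X}\omega$; $X_{0}=-\partial/\partial t^{1}$ satisfies $\mathcal L_{X_{0}}\mathcal J=0$, $\mathcal L_{X_{0}}G=0$,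 $\mathcal J_{2}X_{0}=d\mu^{1}$. $X_{0}$-invariant means invariant under the flow of $X_{0}$. Auxiliary objects. $\mathcal S=\mathrm{span}\{X_{0},\mathcal J_{1}X_{0},\mathcal J_{2}X_{0},\mathcal J_{3}X_{0}\}$, $\mathcal S^{\perp}$ its orthogonal complement (the same for $G$ and $\langle\cdot,\cdot\rangle$), subscript $\mathbb{C}$ = complexification, and $$v_{f}:=X_{0}-i\mathcal JX_{0}-\tfrac{1}{f^{2}}(\mathcal J_{3}X_{0}+i\mathcal J_{2}X_{0}),\quad v_{if}:=X_{0}-i\mathcal JX_{0}+\tfrac{1}{f^{2}}(\mathcal J_{3}X_{0}+i\mathcal J_{2}X_{0}),\quad\alpha:=-d\left(\ln\frac{|f^{2}-1|}{f^{2}G(X_{0},X_{0})}\right).$$ Conditions. (KK1) $F$ vanishes on $\Lambda^{2}\mathrm{pr}_{T}(L_{1}\cap L_{2}\cap\mathcal S_{\mathbb{C}}^{\perp})\oplus\Lambda^{2}\mathrm{pr}_{T}(L_{1}\cap\bar L_{2}\cap\mathcal S_{\mathbb{C}}^{\perp})$, and $F(X,Y)X_{0}\in\Gamma(E_{1})$ for all $X\wedge Y\in\Lambda^{2}E_{1}$. (KK2) For $X\in\Gamma\,\mathrm{pr}_{T}(L_{1}\cap L_{2}\cap\mathcal S^{\perp}_{\mathbb{C}})$: $[\mathrm{pr}_{T}(\mathcal J_{3}X_{0}),X]+\alpha(X)\mathrm{pr}_{T}(\mathcal J_{3}X_{0})+\frac{f^{2}F(\mathrm{pr}_{T}(v_{f}),X)}{a(f^{2}-1)}X_{0}\in\Gamma\,\mathrm{pr}_{T}(L_{1}\cap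 L_{2}\cap\mathcal S^{\perp}_{\mathbb{C}})$; for $X\in\Gamma\,\mathrm{pr}_{T}(L_{1}\cap\bar L_{2}\cap\mathcal S^{\perp}_{\mathbb{C}})$: $[\mathrm{pr}_{T}(\mathcal J_{3}X_{0}),X]+\alpha(X)\mathrm{pr}_{T}(\mathcal J_{3}X_{0})-\frac{f^{2}F(\mathrm{pr}_{T}(v_{if}),X)}{a(f^{2}-1)}X_{0}\in\Gamma\,\mathrm{pr}_{T}(L_{1}\cap\bar L_{2}\cap\mathcal S^{\perp}_{\mathbb{C}})$. (KK3) $X(af^{2}h^{2})=0$ for all $X\in\mathrm{pr}_{T}(\mathcal S^{\perp})$. (KK4) $(i_{X_{0}}\epsilon_{1})\wedge F=-\frac{2a}{h}\epsilon_{1}\wedge dh$ on $\Lambda^{3}E_{1}$, and $\epsilon_{2}\wedge dh=0$ on $\mathrm{pr}_{T}(L_{1}\cap L_{2}\cap\mathcal S_{\mathbb{C}}^{\perp})\wedge\mathrm{pr}_{T}(\bar L_{1}\cap L_{2}\cap\mathcal S_{\mathbb{C}}^{\perp})\wedge\mathrm{pr}_{T}(L_{2}\cap\mathcal S_{\mathbb{C}}^{\perp})$. (KK5) On $\Lambda^{2}\mathrm{pr}_{T}(L_{2}\cap\mathcal S_{\mathbb{C}}^{\perp})$: $$d\left(\frac{1-f^{2}}{f^{2}G(X_{0},X_{0})}\mathrm{pr}_{T^{*}}(\mathcal J_{3}X_{0})\right)+\frac{f^{2}-1}{f^{2}G(X_{0},X_{0})}\mathcal D\epsilon_{2}+\frac{2}{af^{2}}F=\frac{2}{hG(X_{0},X_{0})}\left(\mathrm{pr}_{T}(v_{f})(h)\epsilon_{2}+\mathrm{pr}_{T^{*}}(v_{f})\wedge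 dh\right),$$ where, with $Z:=\mathrm{pr}_{T}(\mathcal J_{3}X_{0})$, $(\mathcal D\epsilon_{2})(X,Y)=Z(\epsilon_{2}(X,Y))-\epsilon_{2}([Z,X]+\alpha(X)Z,Y)-\epsilon_{2}(X,[Z,Y]+\alpha(Y)Z)$. *)

theory Defs
  imports "HOL-Analysis.Analysis"
begin

section \<open>Calculus on open subsets of Euclidean space\<close>

text \<open>All derivatives are used only at points of an open set, so derivatives \<open>at x\<close>
  (and not \<open>at x within S\<close>) are the right ones.\<close>

primrec k_smooth_on :: "nat \<Rightarrow> 'a::real_normed_vector set \<Rightarrow> ('a \<Rightarrow> 'b::real_normed_vector) \<Rightarrow> bool"
  where
    "k_smooth_on 0 S f \<longleftrightarrow> continuous_on S f"
  | "k_smooth_on (Suc k) S f \<longleftrightarrow> (\<forall>x\<in>S. f differentiable at x) \<and>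
       (\<forall>v. k_smooth_on k S (\<lambda>x. frechet_derivative f (at x) v))"

definition smooth_on :: "'a::real_normed_vector set \<Rightarrow> ('a \<Rightarrow> 'b::real_normed_vector) \<Rightarrow> bool"
  where "smooth_on S f \<longleftrightarrow> (\<forall>k. k_smooth_on k S f)"

definition partial_deriv :: "'n::finite \<Rightarrow> (real^'n \<Rightarrow> real) \<Rightarrow> real^'n \<Rightarrow> real"
  where "partial_deriv i \<phi> x = frechet_derivative \<phi> (at x) (axis i 1)"

definition hessian :: "(real^'n::finite \<Rightarrow> real) \<Rightarrow> real^'n \<Rightarrow> real^'n^'n"
  where "hessian \<phi> x = (\<chi> i j. partial_deriv i (partial_deriv j \<phi>) x)"


section \<open>Tangent, cotangent and generalized tangent vectors in dimension four\<close>

text \<open>The manifold is an open subset of \<open>real^4\<close>.  Tangent vectors and covectors are both given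
  by their components in the coordinate (dual) basis; the complexified spaces use \<open>complex^4\<close>.
  An element \<open>X + \<xi>\<close> of the generalized tangent space is the pair \<open>(X, \<xi>)\<close>, so that the two
  projections are \<open>fst\<close> and \<open>snd\<close>.  A vector field, form or endomorphism field takes the base
  point as its first argument.\<close>

type_synonym gtan = "(real^4) \<times> (real^4)"
type_synonym gtanC = "(complex^4) \<times> (complex^4)"

definition ev :: "'a::field^4 \<Rightarrow> 'a^4 \<Rightarrow> 'a"
  where "ev \<xi> X = (\<Sum>k\<in>UNIV. \<xi> $ k * X $ k)"

definition pairing :: "('a::field^4) \<times> ('a^4) \<Rightarrow> ('a^4) \<times> ('a^4) \<Rightarrow> 'a"
  where "pairing u v = (ev (snd v) (fst u) + ev (snd u) (fst v)) / 2"

definition vcx :: "real^4 \<Rightarrow> complex^4" where "vcx X = (\<chi> k. complex_of_real (X $ k))"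
definition vRe :: "complex^4 \<Rightarrow> real^4" where "vRe X = (\<chi> k. Re (X $ k))"
definition vIm :: "complex^4 \<Rightarrow> real^4" where "vIm X = (\<chi> k. Im (X $ k))"

definition gcx :: "gtan \<Rightarrow> gtanC" where "gcx u = (vcx (fst u), vcx (snd u))"
definition gRe :: "gtanC \<Rightarrow> gtan" where "gRe u = (vRe (fst u), vRe (snd u))"
definition gIm :: "gtanC \<Rightarrow> gtan" where "gIm u = (vIm (fst u), vIm (snd u))"
definition gcnj :: "gtanC \<Rightarrow> gtanC"
  where "gcnj u = ((\<chi> k. cnj (fst u $ k)), (\<chi> k. cnj (snd u $ k)))"
definition gscale :: "complex \<Rightarrow> gtanC \<Rightarrow> gtanC"
  where "gscale c u = (c *s fst u, c *s snd u)"

definition cx_endo :: "(gtan \<Rightarrow> gtan) \<Rightarrow> gtanC \<Rightarrow> gtanC"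
  where "cx_endo A u = gcx (A (gRe u)) + gscale \<i> (gcx (A (gIm u)))"

definition cx_form :: "(real^4 \<Rightarrow> real^4 \<Rightarrow> real) \<Rightarrow> complex^4 \<Rightarrow> complex^4 \<Rightarrow> complex"
  where "cx_form B X Y =
    of_real (B (vRe X) (vRe Y) - B (vIm X) (vIm Y)) +
    \<i> * of_real (B (vRe X) (vIm Y) + B (vIm X) (vRe Y))"

definition cx_sub :: "gtan set \<Rightarrow> gtanC set"
  where "cx_sub W = {u. gRe u \<in> W \<and> gIm u \<in> W}"

definition cnj_sub :: "gtanC set \<Rightarrow> gtanC set"
  where "cnj_sub W = gcnj ` W"


section \<open>Differential forms, vector fields and flows\<close>

text \<open>Wedge products use the convention without factorials,
  \<open>(\<alpha> \<and> \<beta>)(X, Y) = \<alpha>(X) \<beta>(Y) - \<alpha>(Y) \<beta>(X)\<close>, and exterior derivatives the matching one.\<close>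

definition wedge11 :: "('v \<Rightarrow> 'k::field) \<Rightarrow> ('v \<Rightarrow> 'k) \<Rightarrow> 'v \<Rightarrow> 'v \<Rightarrow> 'k"
  where "wedge11 \<alpha> \<beta> X Y = \<alpha> X * \<beta> Y - \<alpha> Y * \<beta> X"

definition wedge12 :: "('v \<Rightarrow> 'k::field) \<Rightarrow> ('v \<Rightarrow> 'v \<Rightarrow> 'k) \<Rightarrow> 'v \<Rightarrow> 'v \<Rightarrow> 'v \<Rightarrow> 'k"
  where "wedge12 \<alpha> B X Y Z = \<alpha> X * B Y Z + \<alpha> Y * B Z X + \<alpha> Z * B X Y"

definition wedge21 :: "('v \<Rightarrow> 'v \<Rightarrow> 'k::field) \<Rightarrow> ('v \<Rightarrow> 'k) \<Rightarrow> 'v \<Rightarrow> 'v \<Rightarrow> 'v \<Rightarrow> 'k"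
  where "wedge21 B \<alpha> X Y Z = B X Y * \<alpha> Z + B Y Z * \<alpha> X + B Z X * \<alpha> Y"

text \<open>Derivative of a complex function along a complex tangent vector.\<close>

definition cdir :: "(real^4 \<Rightarrow> complex) \<Rightarrow> real^4 \<Rightarrow> complex^4 \<Rightarrow> complex"
  where "cdir \<phi> p X =
    frechet_derivative \<phi> (at p) (vRe X) + \<i> * frechet_derivative \<phi> (at p) (vIm X)"

definition cdiff :: "(real^4 \<Rightarrow> real) \<Rightarrow> real^4 \<Rightarrow> complex^4 \<Rightarrow> complex"
  where "cdiff \<phi> = cdir (\<lambda>q. complex_of_real (\<phi> q))"

definition lie_bracket :: "(real^4 \<Rightarrow> complex^4) \<Rightarrow> (real^4 \<Rightarrow> complex^4) \<Rightarrow> real^4 \<Rightarrow> complex^4"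
  where "lie_bracket X Y p =
    (\<chi> k. cdir (\<lambda>q. Y q $ k) p (X p) - cdir (\<lambda>q. X q $ k) p (Y p))"

definition ext_deriv1 :: "(real^4 \<Rightarrow> real^4) \<Rightarrow> real^4 \<Rightarrow> real^4 \<Rightarrow> real^4 \<Rightarrow> real"
  where "ext_deriv1 \<theta> p X Y =
    ev (frechet_derivative \<theta> (at p) X) Y - ev (frechet_derivative \<theta> (at p) Y) X"

definition ext_deriv2 ::
  "(real^4 \<Rightarrow> real^4 \<Rightarrow> real^4 \<Rightarrow> real) \<Rightarrow> real^4 \<Rightarrow> real^4 \<Rightarrow> real^4 \<Rightarrow> real^4 \<Rightarrow> real"
  where "ext_deriv2 B p X Y Z =
    frechet_derivative (\<lambda>q. B q Y Z) (at p) X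
    - frechet_derivative (\<lambda>q. B q X Z) (at p) Y
    + frechet_derivative (\<lambda>q. B q X Y) (at p) Z"

definition closed_form2 :: "(real^4) set \<Rightarrow> (real^4 \<Rightarrow> real^4 \<Rightarrow> real^4 \<Rightarrow> real) \<Rightarrow> bool"
  where "closed_form2 M B \<longleftrightarrow>
    (\<forall>X Y. smooth_on M (\<lambda>p. B p X Y)) \<and> (\<forall>p\<in>M. \<forall>X Y Z. ext_deriv2 B p X Y Z = 0)"

definition local_flow ::
  "(real^4) set \<Rightarrow> (real^4 \<Rightarrow> real^4) \<Rightarrow> real set \<Rightarrow> (real^4) set \<Rightarrow> (real \<Rightarrow> real^4 \<Rightarrow> real^4) \<Rightarrow> bool"
  where "local_flow M X T V \<phi> \<longleftrightarrow>
    open T \<and> is_interval T \<and> 0 \<in> T \<and> open V \<and> V \<subseteq> M \<and>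
    (\<forall>s\<in>T. smooth_on V (\<phi> s)) \<and>
    (\<forall>p\<in>V. \<phi> 0 p = p \<and>
       (\<forall>s\<in>T. \<phi> s p \<in> M \<and> ((\<lambda>s. \<phi> s p) has_vector_derivative X (\<phi> s p)) (at s)))"

definition flow_invariant2 ::
  "(real^4) set \<Rightarrow> (real^4 \<Rightarrow> real^4) \<Rightarrow> (real^4 \<Rightarrow> real^4 \<Rightarrow> real^4 \<Rightarrow> real) \<Rightarrow> bool"
  where "flow_invariant2 M X B \<longleftrightarrow>
    (\<forall>T V \<phi>. local_flow M X T V \<phi> \<longrightarrow>
      (\<forall>s\<in>T. \<forall>p\<in>V. \<forall>Y Z.
        B (\<phi> s p) (frechet_derivative (\<phi> s) (at p) Y) (frechet_derivative (\<phi> s) (at p) Z) = B p Y Z))"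

text \<open>Global smooth sections over \<open>M\<close> of a family of complex subspaces of the tangent spaces.\<close>

definition sections :: "(real^4) set \<Rightarrow> (real^4 \<Rightarrow> (complex^4) set) \<Rightarrow> (real^4 \<Rightarrow> complex^4) set"
  where "sections M W = {X. smooth_on M X \<and> (\<forall>p\<in>M. X p \<in> W p)}"


section \<open>The (1,0)-bundles and their presentation by two-forms\<close>

definition eigen10 :: "(gtan \<Rightarrow> gtan) \<Rightarrow> gtanC set"
  where "eigen10 A = {u. cx_endo A u = gscale \<i> u}"

text \<open>The form \<open>\<epsilon>\<close> on \<open>E = fst ` L\<close> with \<open>L = {X + \<xi>. X \<in> E \<and> \<xi> = \<epsilon>(X, _) on E}\<close>.  For \<open>X\<close>, \<open>Y\<close> in \<open>E\<close> the
  value \<open>\<epsilon> X Y\<close> is uniquely determined by this equation; values outside \<open>E\<close> are meaningless.\<close>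

definition eps_form :: "gtanC set \<Rightarrow> complex^4 \<Rightarrow> complex^4 \<Rightarrow> complex"
  where "eps_form L = (SOME \<epsilon>. L = {(X, \<xi>). X \<in> fst ` L \<and> (\<forall>Y \<in> fst ` L. ev \<xi> Y = \<epsilon> X Y)})"


section \<open>The conditions on the twist data\<close>

text \<open>The locale carries no assumptions: it only fixes the field \<open>Gend\<close> of endomorphisms
  representing the generalized metric, the generalized complex structure \<open>J\<close>, the vector field
  \<open>X0\<close>, the two-form \<open>F\<close> and the functions \<open>f\<close>, \<open>a\<close>, \<open>h\<close> on \<open>M\<close>.\<close>

locale twist_data =
  fixes M :: "(real^4) set"
    and Gend J :: "real^4 \<Rightarrow> gtan \<Rightarrow> gtan"
    and X0 :: "real^4 \<Rightarrow> real^4"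
    and F :: "real^4 \<Rightarrow> real^4 \<Rightarrow> real^4 \<Rightarrow> real"
    and f a h :: "real^4 \<Rightarrow> real"
begin

definition J1 :: "real^4 \<Rightarrow> gtan \<Rightarrow> gtan" where "J1 p = J p"
definition J2 :: "real^4 \<Rightarrow> gtan \<Rightarrow> gtan" where "J2 p = Gend p \<circ> J p"
definition J3 :: "real^4 \<Rightarrow> gtan \<Rightarrow> gtan" where "J3 p = J1 p \<circ> J2 p"

definition x0 :: "real^4 \<Rightarrow> gtan" where "x0 p = (X0 p, 0)"

definition GX0 :: "real^4 \<Rightarrow> real"
  where "GX0 p = pairing (Gend p (x0 p)) (x0 p)"

definition S_space :: "real^4 \<Rightarrow> gtan set"
  where "S_space p = span {x0 p, J1 p (x0 p), J2 p (x0 p), J3 p (x0 p)}"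

definition S_perp :: "real^4 \<Rightarrow> gtan set"
  where "S_perp p = {u. \<forall>w \<in> S_space p. pairing u w = 0}"

definition S_perpC :: "real^4 \<Rightarrow> gtanC set" where "S_perpC p = cx_sub (S_perp p)"

definition L1 :: "real^4 \<Rightarrow> gtanC set" where "L1 p = eigen10 (J1 p)"
definition L2 :: "real^4 \<Rightarrow> gtanC set" where "L2 p = eigen10 (J2 p)"

definition E1 :: "real^4 \<Rightarrow> (complex^4) set" where "E1 p = fst ` L1 p"

definition eps1 :: "real^4 \<Rightarrow> complex^4 \<Rightarrow> complex^4 \<Rightarrow> complex" where "eps1 p = eps_form (L1 p)"
definition eps2 :: "real^4 \<Rightarrow> complex^4 \<Rightarrow> complex^4 \<Rightarrow> complex" where "eps2 p = eps_form (L2 p)"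

definition T12 :: "real^4 \<Rightarrow> (complex^4) set"
  where "T12 p = fst ` (L1 p \<inter> L2 p \<inter> S_perpC p)"
definition T12bar :: "real^4 \<Rightarrow> (complex^4) set"
  where "T12bar p = fst ` (L1 p \<inter> cnj_sub (L2 p) \<inter> S_perpC p)"
definition T1bar2 :: "real^4 \<Rightarrow> (complex^4) set"
  where "T1bar2 p = fst ` (cnj_sub (L1 p) \<inter> L2 p \<inter> S_perpC p)"
definition T2 :: "real^4 \<Rightarrow> (complex^4) set"
  where "T2 p = fst ` (L2 p \<inter> S_perpC p)"

definition vf :: "real^4 \<Rightarrow> gtanC"
  where "vf p = gcx (x0 p) - gscale \<i> (gcx (J1 p (x0 p)))
    - gscale (of_real (1 / (f p)\<^sup>2)) (gcx (J3 p (x0 p)) + gscale \<i> (gcx (J2 p (x0 p))))"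

definition vif :: "real^4 \<Rightarrow> gtanC"
  where "vif p = gcx (x0 p) - gscale \<i> (gcx (J1 p (x0 p)))
    + gscale (of_real (1 / (f p)\<^sup>2)) (gcx (J3 p (x0 p)) + gscale \<i> (gcx (J2 p (x0 p))))"

definition alpha :: "real^4 \<Rightarrow> complex^4 \<Rightarrow> complex"
  where "alpha p X = - cdiff (\<lambda>q. ln (\<bar>(f q)\<^sup>2 - 1\<bar> / ((f q)\<^sup>2 * GX0 q))) p X"

definition FC :: "real^4 \<Rightarrow> complex^4 \<Rightarrow> complex^4 \<Rightarrow> complex" where "FC p = cx_form (F p)"

definition Z :: "real^4 \<Rightarrow> complex^4" where "Z p = vcx (fst (J3 p (x0 p)))"

text \<open>The operator \<open>X \<mapsto> [Z, X] + \<alpha>(X) Z\<close> on complex vector fields.\<close>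

definition nablaZ :: "(real^4 \<Rightarrow> complex^4) \<Rightarrow> real^4 \<Rightarrow> complex^4"
  where "nablaZ X p = lie_bracket Z X p + alpha p (X p) *s Z p"

definition Deps2 :: "(real^4 \<Rightarrow> complex^4) \<Rightarrow> (real^4 \<Rightarrow> complex^4) \<Rightarrow> real^4 \<Rightarrow> complex"
  where "Deps2 X Y p = cdir (\<lambda>q. eps2 q (X q) (Y q)) p (Z p)
    - eps2 p (nablaZ X p) (Y p) - eps2 p (X p) (nablaZ Y p)"

definition KK1 :: bool
  where "KK1 \<longleftrightarrow> (\<forall>p\<in>M.
    (\<forall>X\<in>T12 p. \<forall>Y\<in>T12 p. FC p X Y = 0) \<and>
    (\<forall>X\<in>T12bar p. \<forall>Y\<in>T12bar p. FC p X Y = 0) \<and>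
    (\<forall>X\<in>E1 p. \<forall>Y\<in>E1 p. FC p X Y *s vcx (X0 p) \<in> E1 p))"

definition KK2 :: bool
  where "KK2 \<longleftrightarrow>
    (\<forall>X \<in> sections M T12.
      (\<lambda>p. nablaZ X p
        + (of_real ((f p)\<^sup>2) * FC p (fst (vf p)) (X p) / of_real (a p * ((f p)\<^sup>2 - 1))) *s vcx (X0 p))
      \<in> sections M T12) \<and>
    (\<forall>X \<in> sections M T12bar.
      (\<lambda>p. nablaZ X p
        - (of_real ((f p)\<^sup>2) * FC p (fst (vif p)) (X p) / of_real (a p * ((f p)\<^sup>2 - 1))) *s vcx (X0 p))
      \<in> sections M T12bar)"

definition KK3 :: bool
  where "KK3 \<longleftrightarrow> (\<forall>p\<in>M. \<forall>X \<in> fst ` S_perp p.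
    frechet_derivative (\<lambda>q. a q * (f q)\<^sup>2 * (h q)\<^sup>2) (at p) X = 0)"

definition KK4 :: bool
  where "KK4 \<longleftrightarrow> (\<forall>p\<in>M.
    (\<forall>X\<in>E1 p. \<forall>Y\<in>E1 p. \<forall>W\<in>E1 p.
      wedge12 (eps1 p (vcx (X0 p))) (FC p) X Y W
        = - of_real (2 * a p / h p) * wedge21 (eps1 p) (cdiff h p) X Y W) \<and>
    (\<forall>X\<in>T12 p. \<forall>Y\<in>T1bar2 p. \<forall>W\<in>T2 p. wedge21 (eps2 p) (cdiff h p) X Y W = 0))"

definition KK5 :: bool
  where "KK5 \<longleftrightarrow> (\<forall>X \<in> sections M T2. \<forall>Y \<in> sections M T2. \<forall>p\<in>M.
    cx_form (ext_deriv1
        (\<lambda>q. ((1 - (f q)\<^sup>2) / ((f q)\<^sup>2 * GX0 q)) *\<^sub>R snd (J3 q (x0 q))) p) (X p) (Y p)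
      + of_real (((f p)\<^sup>2 - 1) / ((f p)\<^sup>2 * GX0 p)) * Deps2 X Y p
      + of_real (2 / (a p * (f p)\<^sup>2)) * FC p (X p) (Y p)
    = of_real (2 / (h p * GX0 p)) *
      (cdiff h p (fst (vf p)) * eps2 p (X p) (Y p)
        + wedge11 (ev (snd (vf p))) (cdiff h p) (X p) (Y p)))"

end


section \<open>Toric structures in dimension four\<close>

text \<open>The components of a point are, in this order, \<open>t 1\<close>, \<open>t 2\<close>, \<open>\<mu> 1\<close>, \<open>\<mu> 2\<close>.\<close>

definition t_ix :: "2 \<Rightarrow> 4" where "t_ix i = (if i = 1 then 1 else 2)"
definition mu_ix :: "2 \<Rightarrow> 4" where "mu_ix i = (if i = 1 then 3 else 4)"

definition mu :: "real^4 \<Rightarrow> real^2" where "mu p = (\<chi> i. p $ mu_ix i)"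

definition del_t :: "2 \<Rightarrow> real^4" where "del_t i = axis (t_ix i) 1"
definition del_mu :: "2 \<Rightarrow> real^4" where "del_mu i = axis (mu_ix i) 1"
definition dt :: "2 \<Rightarrow> real^4 \<Rightarrow> real" where "dt i X = X $ t_ix i"
definition dmu :: "2 \<Rightarrow> real^4 \<Rightarrow> real" where "dmu i X = X $ mu_ix i"

definition Psi :: "(real^2 \<Rightarrow> real) \<Rightarrow> real^2^2 \<Rightarrow> real^2 \<Rightarrow> real^2^2"
  where "Psi \<tau> C m = hessian \<tau> m + C"

definition Psi12s :: "(real^2 \<Rightarrow> real) \<Rightarrow> real^2^2 \<Rightarrow> real^2 \<Rightarrow> real"
  where "Psi12s \<tau> C m = (Psi \<tau> C m $ 1 $ 2 + Psi \<tau> C m $ 2 $ 1) / 2"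

definition Jplus :: "real^2^2 \<Rightarrow> real^4 \<Rightarrow> real^4"
  where "Jplus P X =
    (\<Sum>i\<in>UNIV. \<Sum>j\<in>UNIV. (P $ i $ j * dmu j X) *\<^sub>R del_t i)
    - (\<Sum>i\<in>UNIV. \<Sum>j\<in>UNIV. (matrix_inv P $ i $ j * dt j X) *\<^sub>R del_mu i)"

definition Jminus :: "real^2^2 \<Rightarrow> real^4 \<Rightarrow> real^4"
  where "Jminus P X =
    (\<Sum>i\<in>UNIV. \<Sum>j\<in>UNIV. (P $ j $ i * dmu j X) *\<^sub>R del_t i)
    - (\<Sum>i\<in>UNIV. \<Sum>j\<in>UNIV. (matrix_inv P $ j $ i * dt j X) *\<^sub>R del_mu i)"

definition omega :: "real^4 \<Rightarrow> real^4 \<Rightarrow> real"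
  where "omega X Y = (\<Sum>i\<in>UNIV. wedge11 (dmu i) (dt i) X Y)"

text \<open>\<open>X \<mapsto> i\<^sub>X \<omega>\<close>, as a covector.\<close>

definition omega_map :: "real^4 \<Rightarrow> real^4"
  where "omega_map X = (\<chi> k. omega X (axis k 1))"

definition gmap :: "real^2^2 \<Rightarrow> real^4 \<Rightarrow> real^4"
  where "gmap P X = (- 1/2) *\<^sub>R omega_map (Jplus P X + Jminus P X)"

definition bmap :: "real^2^2 \<Rightarrow> real^4 \<Rightarrow> real^4"
  where "bmap P X = (- 1/2) *\<^sub>R omega_map (Jplus P X - Jminus P X)"

text \<open>The pair \<open>(Gend, J)\<close> at a point with matrix \<open>P\<close>.  Since the graphs of \<open>b + g\<close> and \<open>b - g\<close>
  are complementary, the conditions determine both endomorphisms.\<close>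

definition toric_structure :: "real^2^2 \<Rightarrow> (gtan \<Rightarrow> gtan) \<Rightarrow> (gtan \<Rightarrow> gtan) \<Rightarrow> bool"
  where "toric_structure P Gend J \<longleftrightarrow>
    linear Gend \<and> linear J \<and>
    (\<forall>X. Gend (X, bmap P X + gmap P X) = (X, bmap P X + gmap P X)) \<and>
    (\<forall>X. Gend (X, bmap P X - gmap P X) = - (X, bmap P X - gmap P X)) \<and>
    (\<forall>X. J (X, bmap P X + gmap P X)
      = (Jplus P X, bmap P (Jplus P X) + gmap P (Jplus P X))) \<and>
    (\<forall>X. J (X, bmap P X - gmap P X)
      = (Jminus P X, bmap P (Jminus P X) - gmap P (Jminus P X)))"

end

theory Submission
  imports Defs
begin

text \<open>
  All data depend on the momenta \<open>\<mu>\<close> only, and the conditions become explicit once the structure is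
  written in the coordinate frame.  At a point let \<open>H\<close> be the Hessian, with entries \<open>p, q, r\<close>, let
  \<open>c = C\<^sub>1\<^sub>2\<close>, \<open>D = det H\<close>, \<open>\<rho> = r / D\<close>, \<open>\<psi> = q / r\<close>, and let \<open>\<kappa> = 2 a h' / h\<close> be the first coefficient
  of \<open>F\<close>.  Three facts carry the proof.

  \<^item> The structure \<open>J\<^sub>2\<close> is \<open>X + \<xi> \<mapsto> - \<omega>\<inverse> \<xi> + i\<^sub>X \<omega>\<close> (\<open>Gend_J_eq\<close>), and \<open>J\<^sub>1\<close> is an explicit block matrix
    (\<open>J_eq\<close>).  Hence \<open>\<epsilon>\<^sub>2 = - i \<omega>\<close>, and since \<open>C\<close> is invertible also \<open>L\<^sub>1\<close> is a graph over the whole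
    complexified tangent space, with
    \<open>\<epsilon>\<^sub>1 = (1/c) (dt\<^sub>1 + i (p d\<mu>\<^sub>1 + q d\<mu>\<^sub>2)) \<and> (dt\<^sub>2 + i (q d\<mu>\<^sub>1 + r d\<mu>\<^sub>2)) - c d\<mu>\<^sub>1 \<and> d\<mu>\<^sub>2\<close>.
    The space \<open>S\<^sup>\<bottom>\<close> projects into \<open>d\<mu>\<^sub>1 = 0\<close>, and the two spaces that occur in the first two conditions are
    the lines spanned by \<open>\<partial>\<mu>\<^sub>2 - i (q \<plusminus> c) \<partial>t\<^sub>1 - i r \<partial>t\<^sub>2\<close> (\<open>T12_iff\<close>, \<open>T12bar_iff\<close>).

  \<^item> Along \<open>d\<mu>\<^sub>1 = 0\<close> the functions \<open>f\<^sup>2\<close> and \<open>h\<close>, which are functions of \<open>\<mu>\<^sub>1\<close>, and \<open>\<psi>\<close>, by the hypothesis on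
    \<open>\<Psi>\<close>, have zero derivative.  Therefore \<open>\<alpha> = d ln \<rho>\<close> there.  Since \<open>Z = - c \<rho> (\<psi> \<partial>t\<^sub>1 + \<partial>t\<^sub>2)\<close>, the
    derivative of \<open>Z\<close> along such an \<open>X\<close> is \<open>\<alpha>(X) Z\<close>, so that \<open>[Z, X] + \<alpha>(X) Z\<close> merely differentiates the
    components of \<open>X\<close> along \<open>Z\<close> (\<open>nablaZ_eq\<close>); and \<open>Z\<close>, having only \<open>t\<close>-components, annihilates all
    functions of the momenta.

  \<^item> The function \<open>f\<close> is chosen such that \<open>\<lambda> = - \<kappa> f\<^sup>2\<close>, and
    \<open>F = \<kappa> d\<mu>\<^sub>1 \<and> dt\<^sub>1 + (\<psi> (\<lambda> - \<kappa>) d\<mu>\<^sub>1 + \<lambda> d\<mu>\<^sub>2) \<and> dt\<^sub>2\<close>.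

  (KK1) holds because \<open>F\<close> vanishes on lines and \<open>E\<^sub>1\<close> is everything.  In (KK2) the two values of \<open>F\<close> are
  \<open>\<minusplus> c \<rho> (\<kappa> + \<lambda> / f\<^sup>2) = 0\<close>, and the remaining terms stay in the line by the second fact.  (KK3) holds
  because \<open>a f\<^sup>2 h\<^sup>2\<close> is a function of \<open>\<mu>\<^sub>1\<close>.  The first equation of (KK4) is an
  identity of three-forms that follows from \<open>q = \<psi> r\<close>, and the second holds because \<open>d\<mu>\<^sub>1\<close> vanishes on all arguments.
  In (KK5) the operator \<open>\<D>\<close> kills the constant form \<open>\<epsilon>\<^sub>2\<close>, and the one-form to be differentiated is
  \<open>2 (1 / f\<^sup>2 - 1) (dt\<^sub>1 - \<psi> dt\<^sub>2)\<close>, whose differential is a multiple of \<open>d\<mu>\<^sub>1\<close>; what is left is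
  \<open>2 \<lambda> / (a f\<^sup>2) = - 4 h' / h\<close>.  Finally \<open>F\<close> is closed because the differentials of \<open>\<kappa>\<close> and
  \<open>\<psi> (\<lambda> - \<kappa>)\<close> are multiples of \<open>d\<mu>\<^sub>1\<close>, and it is invariant because the flow of \<open>X\<^sub>0\<close> translates \<open>t\<^sub>1\<close>.
\<close>

section \<open>Smooth functions on open sets\<close>

text \<open>Two functions that agree near a point have the same set of derivatives there, from which
  \<open>frechet_derivative\<close> chooses.\<close>
lemma frechet_derivative_cong_open:
  assumes "open S" "x \<in> S" "\<And>y. y \<in> S \<Longrightarrow> f y = g y"
  shows "frechet_derivative f (at x) = frechet_derivative g (at x)"
proof -
  have "(f has_derivative D) (at x) \<longleftrightarrow> (g has_derivative D) (at x)" for D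
    by (rule iffI; erule has_derivative_transform_within_open[OF _ assms(1,2)]) (simp_all add: assms(3))
  then show ?thesis by (simp add: frechet_derivative_def)
qed

lemma frechet_derivative_eqI:
  "(f has_derivative D) (at x) \<Longrightarrow> frechet_derivative f (at x) v = D v"
  by (simp add: frechet_derivative_at[symmetric])

lemma differentiable_cong_open:
  assumes "open S" "x \<in> S" "\<And>y. y \<in> S \<Longrightarrow> f y = g y" "f differentiable at x"
  shows "g differentiable at x"
  using assms has_derivative_transform_within_open[of f _ x UNIV S g]
  unfolding differentiable_def by blast

lemma k_smooth_on_cong:
  "open S \<Longrightarrow> (\<And>x. x \<in> S \<Longrightarrow> f x = g x) \<Longrightarrow> k_smooth_on k S f \<Longrightarrow> k_smooth_on k S g"
proof (induction k arbitrary: f g)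
  case 0
  then show ?case using continuous_on_cong[of S S f g] by simp
next
  case (Suc k)
  have "g differentiable at x" if "x \<in> S" for x
    using differentiable_cong_open[OF Suc.prems(1) that Suc.prems(2)] Suc.prems(3) that by simp
  moreover have "k_smooth_on k S (\<lambda>x. frechet_derivative g (at x) v)" for v
  proof (rule Suc.IH[OF Suc.prems(1), of "\<lambda>x. frechet_derivative f (at x) v"])
    show "frechet_derivative f (at x) v = frechet_derivative g (at x) v" if "x \<in> S" for x
      using frechet_derivative_cong_open[OF Suc.prems(1) that Suc.prems(2)] by simp
    show "k_smooth_on k S (\<lambda>x. frechet_derivative f (at x) v)"
      using Suc.prems(3) by simp
  qed
  ultimately show ?case by simp
qed

lemma smooth_on_cong:
  "open S \<Longrightarrow> (\<And>x. x \<in> S \<Longrightarrow> f x = g x) \<Longrightarrow> smooth_on S f \<Longrightarrow> smooth_on S g"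
  unfolding smooth_on_def by (blast intro: k_smooth_on_cong)

lemma k_smooth_on_Suc_imp: "k_smooth_on (Suc k) S f \<Longrightarrow> k_smooth_on k S f"
proof (induction k arbitrary: f)
  case 0
  then show ?case
    by (auto intro!: continuous_at_imp_continuous_on differentiable_imp_continuous_within)
next
  case (Suc k)
  show ?case
    unfolding k_smooth_on.simps(2)[of k]
    using Suc.prems by (auto simp del: k_smooth_on.simps(2) simp: k_smooth_on.simps(2)[of "Suc k"] intro!: Suc.IH)
qed

text \<open>The closure properties below follow by induction on the order of differentiability, once the
  derivative of the combined function is known by a formula.\<close>
lemma k_smooth_onI_derivative:
  assumes "open S" "\<And>x. x \<in> S \<Longrightarrow> (f has_derivative D x) (at x)"
    and "\<And>v. k_smooth_on k S (\<lambda>x. D x v)"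
  shows "k_smooth_on (Suc k) S f"
proof -
  have "k_smooth_on k S (\<lambda>x. frechet_derivative f (at x) v)" for v
    using assms(1) _ assms(3)[of v]
    by (rule k_smooth_on_cong) (simp add: frechet_derivative_eqI[OF assms(2)])
  with assms(2) show ?thesis by (auto simp: differentiable_def)
qed

lemma smooth_on_differentiable: "smooth_on S f \<Longrightarrow> x \<in> S \<Longrightarrow> f differentiable at x"
  unfolding smooth_on_def by (drule spec[of _ "Suc 0"]) simp

lemma smooth_on_has_derivative:
  "smooth_on S f \<Longrightarrow> x \<in> S \<Longrightarrow> (f has_derivative frechet_derivative f (at x)) (at x)"
  using smooth_on_differentiable frechet_derivative_works by blast

lemma smooth_on_frechet_derivative:
  "smooth_on S f \<Longrightarrow> smooth_on S (\<lambda>x. frechet_derivative f (at x) v)"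
  unfolding smooth_on_def
proof
  show "\<forall>k. k_smooth_on k S f \<Longrightarrow> k_smooth_on k S (\<lambda>x. frechet_derivative f (at x) v)" for k
    by (drule spec[of _ "Suc k"]) simp
qed

lemma smooth_on_continuous: "smooth_on S f \<Longrightarrow> continuous_on S f"
  unfolding smooth_on_def by (drule spec[of _ 0]) simp

lemma k_smooth_on_const: "k_smooth_on k S (\<lambda>x. c)"
  by (induction k arbitrary: c) auto

lemma smooth_on_const: "smooth_on S (\<lambda>x. c)"
  by (simp add: smooth_on_def k_smooth_on_const)

lemma k_smooth_on_add:
  "open S \<Longrightarrow> k_smooth_on k S f \<Longrightarrow> k_smooth_on k S g \<Longrightarrow> k_smooth_on k S (\<lambda>x. f x + g x)"
proof (induction k arbitrary: f g)
  case 0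
  then show ?case by (simp add: continuous_on_add)
next
  case (Suc k)
  show ?case
  proof (rule k_smooth_onI_derivative[OF Suc.prems(1)])
    fix x assume "x \<in> S"
    with Suc.prems show "((\<lambda>x. f x + g x) has_derivative
        (\<lambda>v. frechet_derivative f (at x) v + frechet_derivative g (at x) v)) (at x)"
      by (intro has_derivative_add) (auto simp: frechet_derivative_works)
  qed (use Suc in auto)
qed

lemma smooth_on_add:
  "open S \<Longrightarrow> smooth_on S f \<Longrightarrow> smooth_on S g \<Longrightarrow> smooth_on S (\<lambda>x. f x + g x)"
  by (simp add: smooth_on_def k_smooth_on_add)

lemma (in bounded_bilinear) k_smooth_on_prod:
  "open S \<Longrightarrow> k_smooth_on k S f \<Longrightarrow> k_smooth_on k S g \<Longrightarrow> k_smooth_on k S (\<lambda>x. prod (f x) (g x))"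
proof (induction k arbitrary: f g)
  case 0
  then show ?case by (simp add: continuous_on)
next
  case (Suc k)
  show ?case
  proof (rule k_smooth_onI_derivative[OF Suc.prems(1)])
    fix x assume "x \<in> S"
    with Suc.prems show "((\<lambda>x. prod (f x) (g x)) has_derivative
        (\<lambda>v. prod (f x) (frechet_derivative g (at x) v) + prod (frechet_derivative f (at x) v) (g x))) (at x)"
      by (intro FDERIV) (auto simp: frechet_derivative_works)
  next
    fix v
    show "k_smooth_on k S
        (\<lambda>x. prod (f x) (frechet_derivative g (at x) v) + prod (frechet_derivative f (at x) v) (g x))"
      using Suc.prems(2,3)
      by (intro k_smooth_on_add Suc.IH Suc.prems(1) k_smooth_on_Suc_imp[OF Suc.prems(2)]
          k_smooth_on_Suc_imp[OF Suc.prems(3)]) simp_all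
  qed
qed

lemma (in bounded_bilinear) smooth_on_prod:
  "open S \<Longrightarrow> smooth_on S f \<Longrightarrow> smooth_on S g \<Longrightarrow> smooth_on S (\<lambda>x. prod (f x) (g x))"
  by (simp add: smooth_on_def k_smooth_on_prod)

lemmas smooth_on_mult = bounded_bilinear.smooth_on_prod[OF bounded_bilinear_mult]
lemmas smooth_on_scaleR = bounded_bilinear.smooth_on_prod[OF bounded_bilinear_scaleR]

lemma (in bounded_linear) smooth_on_image:
  assumes "open S" "smooth_on S g"
  shows "smooth_on S (\<lambda>x. f (g x))"
proof -
  have "k_smooth_on k S g \<Longrightarrow> k_smooth_on k S (\<lambda>x. f (g x))" for k g
  proof (induction k arbitrary: g)
    case 0
    then show ?case by (simp add: continuous_on)
  next
    case (Suc k)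
    show ?case
    proof (rule k_smooth_onI_derivative[OF assms(1)])
      fix x assume "x \<in> S"
      with Suc.prems show "((\<lambda>x. f (g x)) has_derivative
          (\<lambda>v. f (frechet_derivative g (at x) v))) (at x)"
        by (intro has_derivative) (auto simp: frechet_derivative_works)
    qed (use Suc in auto)
  qed
  with assms show ?thesis by (simp add: smooth_on_def)
qed

lemma smooth_on_linear_comp:
  assumes "bounded_linear L" "open S" "smooth_on (L ` S) g"
  shows "smooth_on S (\<lambda>x. g (L x))"
proof -
  have "k_smooth_on k (L ` S) g \<Longrightarrow> k_smooth_on k S (\<lambda>x. g (L x))" for k
  proof (induction k arbitrary: g)
    case 0
    then show ?case
      by (simp add: continuous_on_compose2[of "L ` S" g] linear_continuous_on[OF assms(1)])
  next
    case (Suc k)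
    show ?case
    proof (rule k_smooth_onI_derivative[OF assms(2)])
      fix x assume x: "x \<in> S"
      with Suc.prems have "(g has_derivative frechet_derivative g (at (L x))) (at (L x))"
        by (auto simp: frechet_derivative_works)
      from has_derivative_compose[OF bounded_linear_imp_has_derivative[OF assms(1)] this]
      show "((\<lambda>x. g (L x)) has_derivative (\<lambda>v. frechet_derivative g (at (L x)) (L v))) (at x)" .
    qed (use Suc in auto)
  qed
  with assms show ?thesis by (simp add: smooth_on_def)
qed

lemma smooth_on_minus: "open S \<Longrightarrow> smooth_on S f \<Longrightarrow> smooth_on S (\<lambda>x. - f x)"
  by (rule bounded_linear.smooth_on_image[OF bounded_linear_minus[OF bounded_linear_ident]])

lemma smooth_on_diff:
  "open S \<Longrightarrow> smooth_on S f \<Longrightarrow> smooth_on S g \<Longrightarrow> smooth_on S (\<lambda>x. f x - g x)"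
  using smooth_on_add[OF _ _ smooth_on_minus, of S f g] by simp

lemma smooth_on_inverse:
  fixes f :: "'a::real_normed_vector \<Rightarrow> real"
  assumes "open S" "smooth_on S f" "\<And>x. x \<in> S \<Longrightarrow> f x \<noteq> 0"
  shows "smooth_on S (\<lambda>x. inverse (f x))"
proof -
  have "k_smooth_on k S (\<lambda>x. inverse (f x))" for k
  proof (induction k)
    case 0
    then show ?case using assms smooth_on_continuous by (auto intro!: continuous_on_inverse)
  next
    case (Suc k)
    show ?case
    proof (rule k_smooth_onI_derivative[OF assms(1)])
      fix x assume x: "x \<in> S"
      show "((\<lambda>x. inverse (f x)) has_derivative
          (\<lambda>v. - 1 * (inverse (f x) * frechet_derivative f (at x) v * inverse (f x)))) (at x)"
        using Deriv.has_derivative_inverse[OF assms(3)[OF x] smooth_on_has_derivative[OF assms(2) x]] by simp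
    next
      show "k_smooth_on k S
          (\<lambda>x. - 1 * (inverse (f x) * frechet_derivative f (at x) v * inverse (f x)))" for v
        using Suc smooth_on_frechet_derivative[OF assms(2), of v] assms(1)
        by (intro bounded_bilinear.k_smooth_on_prod[OF bounded_bilinear_mult] k_smooth_on_const)
           (simp_all add: smooth_on_def)
    qed
  qed
  then show ?thesis by (simp add: smooth_on_def)
qed

lemma smooth_on_divide:
  fixes f g :: "'a::real_normed_vector \<Rightarrow> real"
  shows "open S \<Longrightarrow> smooth_on S f \<Longrightarrow> smooth_on S g \<Longrightarrow> (\<And>x. x \<in> S \<Longrightarrow> g x \<noteq> 0)
    \<Longrightarrow> smooth_on S (\<lambda>x. f x / g x)"
  by (simp add: divide_inverse smooth_on_mult smooth_on_inverse)

lemma smooth_on_component: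
  fixes X :: "'b::real_normed_vector \<Rightarrow> 'c::euclidean_space ^ 'n::finite"
  shows "open S \<Longrightarrow> smooth_on S X \<Longrightarrow> smooth_on S (\<lambda>x. X x $ k)"
  by (rule bounded_linear.smooth_on_image[OF bounded_linear_vec_nth])

lemma smooth_on_sum:
  assumes "open S" "\<And>i. i \<in> I \<Longrightarrow> smooth_on S (f i)"
  shows "smooth_on S (\<lambda>x. \<Sum>i\<in>I. f i x)"
  using assms(2)
proof (induction I rule: infinite_finite_induct)
  case (insert i I)
  then show ?case
    using smooth_on_add[OF assms(1), of "f i" "\<lambda>x. \<Sum>i\<in>I. f i x"] by simp
qed (simp_all add: smooth_on_const)

lemma smooth_on_vecI:
  fixes X :: "'b::real_normed_vector \<Rightarrow> 'c::euclidean_space ^ 'n::finite"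
  assumes "open S" "\<And>k. smooth_on S (\<lambda>x. X x $ k)"
  shows "smooth_on S X"
proof -
  have "bounded_linear (axis k :: 'c \<Rightarrow> 'c ^ 'n)" for k
    by (intro linear_conv_bounded_linear[THEN iffD1] linearI) (auto simp: vec_eq_iff axis_def)
  then have "smooth_on S (\<lambda>x. \<Sum>k\<in>UNIV. axis k (X x $ k))"
    by (intro smooth_on_sum[OF assms(1)] bounded_linear.smooth_on_image[OF _ assms(1,2)])
  moreover have "(\<Sum>k\<in>UNIV. axis k (X x $ k)) = X x" for x
    by (simp add: vec_eq_iff axis_def sum.delta if_distrib cong: if_cong)
  ultimately show ?thesis by simp
qed

section \<open>Symmetry of second derivatives\<close>

text \<open>The mean value theorem in direction \<open>u\<close>, then in direction \<open>v\<close>.  The left-hand side of the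
  equation is symmetric in \<open>u\<close> and \<open>v\<close>, which is why it can be compared with the mixed derivative
  taken in the other order.\<close>
lemma second_difference_mvt:
  fixes f :: "'a::real_normed_vector \<Rightarrow> real"
  assumes s: "0 < s"
    and S: "\<And>r r'. \<lbrakk>0 \<le> r; r \<le> s; 0 \<le> r'; r' \<le> s\<rbrakk> \<Longrightarrow> x + r *\<^sub>R u + r' *\<^sub>R v \<in> S"
    and f: "k_smooth_on (Suc (Suc 0)) S f"
  obtains r r' where "0 < r" "r < s" "0 < r'" "r' < s"
    "f (x + s *\<^sub>R u + s *\<^sub>R v) - f (x + s *\<^sub>R u) - f (x + s *\<^sub>R v) + f x
      = s\<^sup>2 * frechet_derivative (\<lambda>y. frechet_derivative f (at y) u) (at (x + r *\<^sub>R u + r' *\<^sub>R v)) v"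
proof -
  define Du where "Du = (\<lambda>y. frechet_derivative f (at y) u)"
  have df: "(f has_derivative frechet_derivative f (at y)) (at y)" if "y \<in> S" for y
    using f that by (auto simp: frechet_derivative_works)
  have dDu: "(Du has_derivative frechet_derivative Du (at y)) (at y)" if "y \<in> S" for y
    using f that by (auto simp: frechet_derivative_works Du_def)
  have line: "((\<lambda>r. g (b + r *\<^sub>R w)) has_real_derivative frechet_derivative g (at (b + t *\<^sub>R w)) w) (at t)"
    if "(g has_derivative frechet_derivative g (at (b + t *\<^sub>R w))) (at (b + t *\<^sub>R w))"
    for g :: "'a \<Rightarrow> real" and b w t
  proof -
    have "((\<lambda>r. b + r *\<^sub>R w) has_derivative (\<lambda>r. r *\<^sub>R w)) (at t)"
      by (auto intro!: derivative_eq_intros)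
    from has_derivative_compose[OF this that]
    have "((\<lambda>r. g (b + r *\<^sub>R w)) has_derivative (\<lambda>r. frechet_derivative g (at (b + t *\<^sub>R w)) (r *\<^sub>R w))) (at t)" .
    moreover have "frechet_derivative g (at (b + t *\<^sub>R w)) (r *\<^sub>R w)
        = frechet_derivative g (at (b + t *\<^sub>R w)) w * r" for r
      using linear_scale[OF has_derivative_linear[OF that]] by simp
    ultimately show ?thesis by (simp add: has_field_derivative_def)
  qed
  \<comment> \<open>the second difference is the increment of \<open>\<phi>\<close> over \<open>[0, s]\<close>\<close>
  define \<phi> where "\<phi> = (\<lambda>r. f ((x + s *\<^sub>R v) + r *\<^sub>R u) - f (x + r *\<^sub>R u))"
  have in1: "(x + s *\<^sub>R v) + r *\<^sub>R u \<in> S" and in2: "x + r *\<^sub>R u \<in> S" if "0 \<le> r" "r \<le> s" for r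
    using S[of r s] S[of r 0] that s by (simp_all add: algebra_simps)
  have "\<exists>r>0. r < s \<and> \<phi> s - \<phi> 0 = (s - 0) * (Du ((x + s *\<^sub>R v) + r *\<^sub>R u) - Du (x + r *\<^sub>R u))"
    unfolding \<phi>_def Du_def by (rule MVT2[OF s]) (intro DERIV_diff line df in1 in2)
  then obtain r where r: "0 < r" "r < s"
    and \<phi>: "\<phi> s - \<phi> 0 = s * (Du ((x + s *\<^sub>R v) + r *\<^sub>R u) - Du (x + r *\<^sub>R u))" by auto
  have "\<exists>r'>0. r' < s \<and> Du ((x + r *\<^sub>R u) + s *\<^sub>R v) - Du ((x + r *\<^sub>R u) + 0 *\<^sub>R v)
      = (s - 0) * frechet_derivative Du (at ((x + r *\<^sub>R u) + r' *\<^sub>R v)) v"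
    using r by (intro MVT2[OF s] line dDu S) auto
  then obtain r' where r': "0 < r'" "r' < s"
    and Du: "Du (x + r *\<^sub>R u + s *\<^sub>R v) - Du (x + r *\<^sub>R u)
      = s * frechet_derivative Du (at (x + r *\<^sub>R u + r' *\<^sub>R v)) v" by auto
  have "\<phi> s - \<phi> 0 = s * (s * frechet_derivative Du (at (x + r *\<^sub>R u + r' *\<^sub>R v)) v)"
    unfolding \<phi> Du[symmetric] by (simp add: add.commute add.left_commute)
  then have "f (x + s *\<^sub>R u + s *\<^sub>R v) - f (x + s *\<^sub>R u) - f (x + s *\<^sub>R v) + f x
      = s\<^sup>2 * frechet_derivative Du (at (x + r *\<^sub>R u + r' *\<^sub>R v)) v"
    by (simp add: \<phi>_def power2_eq_square algebra_simps)
  with r r' show ?thesis using that unfolding Du_def by blast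
qed

text \<open>Both mixed derivatives are approximated by the same second difference over a small
  parallelogram at \<open>x\<close>, so continuity makes them equal.  Applied to \<open>\<tau>\<close>, this makes the Hessian
  symmetric.\<close>
lemma frechet_derivative_commute:
  fixes f :: "'a::real_normed_vector \<Rightarrow> real"
  assumes S: "open S" and x: "x \<in> S" and f: "k_smooth_on (Suc (Suc 0)) S f"
  shows "frechet_derivative (\<lambda>y. frechet_derivative f (at y) u) (at x) v
    = frechet_derivative (\<lambda>y. frechet_derivative f (at y) v) (at x) u"
proof -
  define A where "A u v y = frechet_derivative (\<lambda>y. frechet_derivative f (at y) u) (at y) v" for u v y
  have cont: "continuous_on S (A u v)" for u v
    using f unfolding A_def by simp
  have "\<bar>A u v x - A v u x\<bar> \<le> 2 * e" if e: "e > 0" for e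
  proof -
    obtain d1 where d1: "d1 > 0" "\<And>y. y \<in> S \<Longrightarrow> dist y x < d1 \<Longrightarrow> dist (A u v y) (A u v x) < e"
      using cont[of u v] x e unfolding continuous_on_iff by blast
    obtain d2 where d2: "d2 > 0" "\<And>y. y \<in> S \<Longrightarrow> dist y x < d2 \<Longrightarrow> dist (A v u y) (A v u x) < e"
      using cont[of v u] x e unfolding continuous_on_iff by blast
    obtain d3 where d3: "d3 > 0" "\<And>y. dist y x < d3 \<Longrightarrow> y \<in> S"
      using S x unfolding open_dist by blast
    define d where "d = min d1 (min d2 d3)"
    \<comment> \<open>small enough for the whole parallelogram to lie within distance \<open>d\<close> of \<open>x\<close>\<close>
    define s where "s = d / (2 * (norm u + norm v + 1))"
    have d: "d > 0" using d1 d2 d3 by (simp add: d_def)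
    have N: "norm u + norm v + 1 > 0" by (simp add: add_nonneg_pos)
    have s: "s > 0" using d N by (simp add: s_def)
    have near: "dist (x + r *\<^sub>R u + r' *\<^sub>R v) x < d"
      if "0 \<le> r" "r \<le> s" "0 \<le> r'" "r' \<le> s" for r r'
    proof -
      have "norm (r *\<^sub>R u + r' *\<^sub>R v) \<le> r * norm u + r' * norm v"
        using norm_triangle_ineq[of "r *\<^sub>R u" "r' *\<^sub>R v"] that by simp
      also have "\<dots> \<le> s * norm u + s * norm v"
        using that by (intro add_mono mult_right_mono) auto
      also have "\<dots> \<le> s * (norm u + norm v + 1)" using s by (simp add: algebra_simps)
      also have "\<dots> = d / 2" using N by (simp add: s_def field_simps)
      also have "\<dots> < d" using d by simp
      finally show ?thesis by (simp add: dist_norm algebra_simps)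
    qed
    have inS: "x + r *\<^sub>R u + r' *\<^sub>R v \<in> S"
      if "0 \<le> r" "r \<le> s" "0 \<le> r'" "r' \<le> s" for r r'
      by (rule d3(2)) (use near[OF that] in \<open>simp add: d_def\<close>)
    obtain r r' where r: "0 < r" "r < s" "0 < r'" "r' < s"
      and 1: "f (x + s *\<^sub>R u + s *\<^sub>R v) - f (x + s *\<^sub>R u) - f (x + s *\<^sub>R v) + f x
        = s\<^sup>2 * A u v (x + r *\<^sub>R u + r' *\<^sub>R v)"
      unfolding A_def by (rule second_difference_mvt[OF s inS f])
    have inS': "x + r *\<^sub>R v + r' *\<^sub>R u \<in> S"
      if "0 \<le> r" "r \<le> s" "0 \<le> r'" "r' \<le> s" for r r'
      using inS[of r' r] that by (simp add: add.commute add.left_commute)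
    obtain t t' where t: "0 < t" "t < s" "0 < t'" "t' < s"
      and 2: "f (x + s *\<^sub>R v + s *\<^sub>R u) - f (x + s *\<^sub>R v) - f (x + s *\<^sub>R u) + f x
        = s\<^sup>2 * A v u (x + t *\<^sub>R v + t' *\<^sub>R u)"
      unfolding A_def by (rule second_difference_mvt[OF s inS' f])
    have "s\<^sup>2 * A u v (x + r *\<^sub>R u + r' *\<^sub>R v) = s\<^sup>2 * A v u (x + t' *\<^sub>R u + t *\<^sub>R v)"
      unfolding 1[symmetric] using 2 by (simp add: algebra_simps)
    then have eq: "A u v (x + r *\<^sub>R u + r' *\<^sub>R v) = A v u (x + t' *\<^sub>R u + t *\<^sub>R v)"
      using s by simp
    have "dist (A u v (x + r *\<^sub>R u + r' *\<^sub>R v)) (A u v x) < e"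
      using r by (intro d1 inS) (use near[of r r'] in \<open>auto simp: d_def\<close>)
    moreover have "dist (A v u (x + t' *\<^sub>R u + t *\<^sub>R v)) (A v u x) < e"
      using t by (intro d2 inS) (use near[of t' t] in \<open>auto simp: d_def\<close>)
    ultimately show ?thesis using eq by (simp add: dist_real_def)
  qed
  then have close: "\<bar>A u v x - A v u x\<bar> \<le> 2 * e" if "e > 0" for e
    using that by blast
  have "\<bar>A u v x - A v u x\<bar> \<le> 0"
  proof (rule field_le_epsilon)
    show "\<bar>A u v x - A v u x\<bar> \<le> 0 + e" if "0 < e" for e
      using close[of "e / 2"] that by simp
  qed
  then show ?thesis by (simp add: A_def)
qed

section \<open>Coordinates, pairings and graphs\<close>

lemma vec4_eq_iff: "(X :: 'a^4) = Y \<longleftrightarrow> X $ 1 = Y $ 1 \<and> X $ 2 = Y $ 2 \<and> X $ 3 = Y $ 3 \<and> X $ 4 = Y $ 4"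
  by (simp add: vec_eq_iff forall_4)

lemma coords [simp]:
  "t_ix 1 = 1" "t_ix 2 = 2" "mu_ix 1 = 3" "mu_ix 2 = 4"
  "dt 1 X = X $ 1" "dt 2 X = X $ 2" "dmu 1 X = X $ 3" "dmu 2 X = X $ 4"
  by (simp_all add: t_ix_def mu_ix_def dt_def dmu_def)

lemma mu_nth [simp]: "mu p $ 1 = p $ 3" "mu p $ 2 = p $ 4"
  by (simp_all add: mu_def)

definition vec4 :: "'a \<Rightarrow> 'a \<Rightarrow> 'a \<Rightarrow> 'a \<Rightarrow> 'a^4"
  where "vec4 x\<^sub>1 x\<^sub>2 x\<^sub>3 x\<^sub>4
    = (\<chi> k. if k = 1 then x\<^sub>1 else if k = 2 then x\<^sub>2 else if k = 3 then x\<^sub>3 else x\<^sub>4)"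

lemma vec4_nth [simp]:
  "vec4 x\<^sub>1 x\<^sub>2 x\<^sub>3 x\<^sub>4 $ 1 = x\<^sub>1" "vec4 x\<^sub>1 x\<^sub>2 x\<^sub>3 x\<^sub>4 $ 2 = x\<^sub>2"
  "vec4 x\<^sub>1 x\<^sub>2 x\<^sub>3 x\<^sub>4 $ 3 = x\<^sub>3" "vec4 x\<^sub>1 x\<^sub>2 x\<^sub>3 x\<^sub>4 $ 4 = x\<^sub>4"
  by (simp_all add: vec4_def)

lemma omega_eq: "omega X Y = X $ 3 * Y $ 1 - X $ 1 * Y $ 3 + X $ 4 * Y $ 2 - X $ 2 * Y $ 4"
  by (simp add: omega_def wedge11_def sum_2)

lemma omega_map_eq: "omega_map X = vec4 (X $ 3) (X $ 4) (- X $ 1) (- X $ 2)"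
  by (simp add: vec4_eq_iff omega_map_def omega_eq axis_def)

lemma ev_eq: "ev \<xi> (X :: 'a::field^4) = \<xi> $ 1 * X $ 1 + \<xi> $ 2 * X $ 2 + \<xi> $ 3 * X $ 3 + \<xi> $ 4 * X $ 4"
  by (simp add: ev_def sum_4)

lemma ev_axis: "ev \<xi> (axis k 1) = (\<xi> :: 'a::field^4) $ k"
  by (simp add: ev_def axis_def if_distrib cong: if_cong)

lemma pairing_add: "pairing u (v + w :: gtan) = pairing u v + pairing u w"
  by (simp add: pairing_def ev_eq field_simps)

lemma pairing_scaleR: "pairing u (x *\<^sub>R v :: gtan) = x * pairing u v"
  by (simp add: pairing_def ev_eq field_simps)

lemma ev_inject: "(\<And>X. ev \<xi> X = ev \<eta> X) \<Longrightarrow> \<xi> = (\<eta> :: 'a::field^4)"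
  by (metis ev_axis vec_eq_iff)

text \<open>When \<open>L\<close> projects onto the whole tangent space, pairing a covector with all vectors determines
  it, so every form presenting \<open>L\<close> is the one of the graph.\<close>
lemma eps_form_graph:
  assumes "L = {(X, \<xi>). \<xi> = A X}"
  shows "eps_form L X Y = ev (A X) Y"
proof -
  have dom: "fst ` L = UNIV" using assms by force
  define is_eps where "is_eps \<epsilon> \<longleftrightarrow> L = {(X, \<xi>). X \<in> fst ` L \<and> (\<forall>Y \<in> fst ` L. ev \<xi> Y = \<epsilon> X Y)}" for \<epsilon>
  have "is_eps (\<lambda>X. ev (A X))"
    unfolding is_eps_def dom using assms ev_inject by auto
  then have "is_eps (eps_form L)"
    using someI[of is_eps] by (simp add: eps_form_def is_eps_def[abs_def])
  then have "L = {(X, \<xi>). \<forall>Y. ev \<xi> Y = eps_form L X Y}"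
    by (simp add: is_eps_def dom)
  moreover have "(X, A X) \<in> L" using assms by simp
  ultimately have "(X, A X) \<in> {(X, \<xi>). \<forall>Y. ev \<xi> Y = eps_form L X Y}" by (rule subst)
  then show ?thesis by simp
qed

section \<open>The generalized complex structures at a point\<close>

text \<open>For \<open>H = (p, q; q, r)\<close> and \<open>C = (0, c; -c, 0)\<close>, with \<open>k = 1 / det H\<close> and \<open>e = 1 + c\<^sup>2 / det H\<close>, so that
  \<open>H - C H\<inverse> C = e H\<close>, this is the block matrix sending a vector with \<open>t\<close>- and \<open>\<mu>\<close>-parts \<open>s\<close>, \<open>m\<close> and a
  covector with \<open>dt\<close>- and \<open>d\<mu>\<close>-parts \<open>\<theta>\<close>, \<open>\<sigma>\<close> to the vector \<open>(e H m + C H\<inverse> \<sigma>, H\<inverse> (C \<theta> - s))\<close> and the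
  covector \<open>(H\<inverse> (\<sigma> - C m), - C H\<inverse> s - e H \<theta>)\<close>.  Taking \<open>k\<close> and \<open>e\<close> as arguments keeps the formula
  polynomial, and leaving the field open makes it its own complexification.\<close>
definition toric_J :: "'a::field \<Rightarrow> 'a \<Rightarrow> 'a \<Rightarrow> 'a \<Rightarrow> 'a \<Rightarrow> 'a \<Rightarrow> ('a^4) \<times> ('a^4) \<Rightarrow> ('a^4) \<times> ('a^4)"
  where "toric_J p q r c k e u = (let s = fst u; \<xi> = snd u in
    (vec4 (e * (p * s$3 + q * s$4) + c * k * (p * \<xi>$4 - q * \<xi>$3))
      (e * (q * s$3 + r * s$4) - c * k * (r * \<xi>$3 - q * \<xi>$4))
      (- k * (r * (s$1 - c * \<xi>$2) - q * (s$2 + c * \<xi>$1)))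
      (- k * (p * (s$2 + c * \<xi>$1) - q * (s$1 - c * \<xi>$2))),
     vec4 (k * (r * (\<xi>$3 - c * s$4) - q * (\<xi>$4 + c * s$3)))
      (k * (p * (\<xi>$4 + c * s$3) - q * (\<xi>$3 - c * s$4)))
      (- c * k * (p * s$2 - q * s$1) - e * (p * \<xi>$1 + q * \<xi>$2))
      (c * k * (r * s$1 - q * s$2) - e * (q * \<xi>$1 + r * \<xi>$2))))"

text \<open>The structure \<open>X + \<xi> \<mapsto> - \<omega>\<inverse> \<xi> + i\<^sub>X \<omega>\<close> of the symplectic form.\<close>
definition omega_J :: "('a::field^4) \<times> ('a^4) \<Rightarrow> ('a^4) \<times> ('a^4)"
  where "omega_J u = (vec4 (snd u $ 3) (snd u $ 4) (- snd u $ 1) (- snd u $ 2),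
                      vec4 (fst u $ 3) (fst u $ 4) (- fst u $ 1) (- fst u $ 2))"

lemma linear_toric_J: "linear (toric_J p q r c k e :: gtan \<Rightarrow> gtan)"
  by (rule linearI) (simp_all add: toric_J_def Let_def prod_eq_iff vec4_eq_iff algebra_simps)

lemma linear_omega_J: "linear (omega_J :: gtan \<Rightarrow> gtan)"
  by (rule linearI) (simp_all add: omega_J_def prod_eq_iff vec4_eq_iff algebra_simps)

lemma cx_endo_toric_J:
  "cx_endo (toric_J p q r c k e) u
    = toric_J (of_real p) (of_real q) (of_real r) (of_real c) (of_real k) (of_real e) u"
  by (simp add: cx_endo_def toric_J_def Let_def gcx_def gRe_def gIm_def vcx_def vRe_def vIm_def
      gscale_def prod_eq_iff vec4_eq_iff complex_eq_iff)

lemma cx_endo_omega_J: "cx_endo omega_J u = omega_J u"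
  by (simp add: cx_endo_def omega_J_def gcx_def gRe_def gIm_def vcx_def vRe_def vIm_def
      gscale_def prod_eq_iff vec4_eq_iff complex_eq_iff)

lemma eigen_omega_J: "eigen10 omega_J = {(X, \<xi>). \<xi> = (- \<i>) *s vec4 (X$3) (X$4) (- X$1) (- X$2)}"
  by (auto simp: eigen10_def cx_endo_omega_J omega_J_def gscale_def vec4_eq_iff)

text \<open>The covector part of an element of \<open>L\<^sub>1\<close> as a function of its vector part: with \<open>s\<close>, \<open>m\<close> the
  \<open>t\<close>- and \<open>\<mu>\<close>-parts of \<open>X\<close>, its \<open>dt\<close>-part is \<open>\<theta> = C\<inverse> (s + i H m)\<close> and its \<open>d\<mu>\<close>-part \<open>i H \<theta> + C m\<close>.\<close>
definition eps1_map :: "complex \<Rightarrow> complex \<Rightarrow> complex \<Rightarrow> complex \<Rightarrow> complex^4 \<Rightarrow> complex^4"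
  where "eps1_map p q r c X = (let \<theta>\<^sub>1 = (- X$2 - \<i> * (q * X$3 + r * X$4)) / c;
      \<theta>\<^sub>2 = (X$1 + \<i> * (p * X$3 + q * X$4)) / c in
    vec4 \<theta>\<^sub>1
      \<theta>\<^sub>2
      (\<i> * (p * \<theta>\<^sub>1 + q * \<theta>\<^sub>2) + c * X$4)
      (\<i> * (q * \<theta>\<^sub>1 + r * \<theta>\<^sub>2) - c * X$3))"

text \<open>The \<open>\<mu>\<close>-part of the eigenvalue equation is \<open>C \<theta> = s + i H m\<close>, which determines \<open>\<theta>\<close> because \<open>C\<close> is
  invertible; the \<open>t\<close>-part then determines \<open>\<sigma>\<close>, and the two covector parts of the equation
  follow.\<close>
lemma toric_J_eigen_iff:
  fixes p q r c k e :: complex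
  assumes c: "c \<noteq> 0" and k: "k * (p * r - q\<^sup>2) = 1" and e: "e = 1 + c\<^sup>2 * k"
  shows "toric_J p q r c k e (X, \<xi>) = gscale \<i> (X, \<xi>) \<longleftrightarrow> \<xi> = eps1_map p q r c X"
    (is "?L \<longleftrightarrow> ?R")
proof
  define \<delta>\<^sub>1 where "\<delta>\<^sub>1 = (- X$2 - \<i> * (q * X$3 + r * X$4)) / c"
  define \<delta>\<^sub>2 where "\<delta>\<^sub>2 = (X$1 + \<i> * (p * X$3 + q * X$4)) / c"
  have X2: "X$2 = - c * \<delta>\<^sub>1 - \<i> * (q * X$3 + r * X$4)"
    and X1: "X$1 = c * \<delta>\<^sub>2 - \<i> * (p * X$3 + q * X$4)"
    using c by (simp_all add: \<delta>\<^sub>1_def \<delta>\<^sub>2_def field_simps)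
  have R: "?R \<longleftrightarrow> \<xi>$1 = \<delta>\<^sub>1 \<and> \<xi>$2 = \<delta>\<^sub>2 \<and> \<xi>$3 = \<i> * (p * \<delta>\<^sub>1 + q * \<delta>\<^sub>2) + c * X$4
      \<and> \<xi>$4 = \<i> * (q * \<delta>\<^sub>1 + r * \<delta>\<^sub>2) - c * X$3"
    by (simp add: vec4_eq_iff eps1_map_def \<delta>\<^sub>1_def \<delta>\<^sub>2_def)
  have ii: "\<i> * \<i> = -1" by simp
  {
    assume ?R
    then have xi: "\<xi>$1 = \<delta>\<^sub>1" "\<xi>$2 = \<delta>\<^sub>2" "\<xi>$3 = \<i> * (p * \<delta>\<^sub>1 + q * \<delta>\<^sub>2) + c * X$4"
      "\<xi>$4 = \<i> * (q * \<delta>\<^sub>1 + r * \<delta>\<^sub>2) - c * X$3" unfolding R by auto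
    show ?L
      unfolding toric_J_def Let_def gscale_def prod_eq_iff vec4_eq_iff
      by (simp only: fst_conv snd_conv vec4_nth vector_smult_component xi X1 X2 e, intro conjI)
         (use k ii in algebra)+
  }
  {
    assume ?L
    then have L: "e * (p * X$3 + q * X$4) + c * k * (p * \<xi>$4 - q * \<xi>$3) = \<i> * X$1"
        "e * (q * X$3 + r * X$4) - c * k * (r * \<xi>$3 - q * \<xi>$4) = \<i> * X$2"
        "- k * (r * (X$1 - c * \<xi>$2) - q * (X$2 + c * \<xi>$1)) = \<i> * X$3"
        "- k * (p * (X$2 + c * \<xi>$1) - q * (X$1 - c * \<xi>$2)) = \<i> * X$4"
      by (simp_all add: toric_J_def Let_def gscale_def vec4_eq_iff)
    have "c * (\<xi>$1 - \<delta>\<^sub>1) = 0" "c * (\<xi>$2 - \<delta>\<^sub>2) = 0"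
      using L(3,4) k X1 X2 by algebra+
    then have 12: "\<xi>$1 = \<delta>\<^sub>1" "\<xi>$2 = \<delta>\<^sub>2" using c by auto
    have "c * (\<xi>$3 - (\<i> * (p * \<delta>\<^sub>1 + q * \<delta>\<^sub>2) + c * X$4)) = 0"
      "c * (\<xi>$4 - (\<i> * (q * \<delta>\<^sub>1 + r * \<delta>\<^sub>2) - c * X$3)) = 0"
      using L(1,2) k X1 X2 e ii by algebra+
    then have "\<xi>$3 = \<i> * (p * \<delta>\<^sub>1 + q * \<delta>\<^sub>2) + c * X$4"
      "\<xi>$4 = \<i> * (q * \<delta>\<^sub>1 + r * \<delta>\<^sub>2) - c * X$3" using c by auto
    with 12 show ?R unfolding R by simp
  }
qed

lemma matrix_inv_2x2:
  fixes P :: "real^2^2"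
  defines "N \<equiv> P$1$1 * P$2$2 - P$1$2 * P$2$1"
  assumes "N \<noteq> 0"
  shows "matrix_inv P $ 1 $ 1 = P$2$2 / N" "matrix_inv P $ 1 $ 2 = - P$1$2 / N"
    "matrix_inv P $ 2 $ 1 = - P$2$1 / N" "matrix_inv P $ 2 $ 2 = P$1$1 / N"
proof -
  define Q :: "real^2^2" where "Q = (\<chi> i j. if i = 1 then (if j = 1 then P$2$2 / N else - P$1$2 / N)
      else (if j = 1 then - P$2$1 / N else P$1$1 / N))"
  have PQ: "P ** Q = mat 1"
    using assms by (simp add: vec_eq_iff forall_2 matrix_matrix_mult_def sum_2 Q_def mat_def
        divide_simps N_def)
  moreover have "Q ** P = mat 1" using PQ matrix_left_right_inverse by blast
  moreover have "P ** matrix_inv P = mat 1"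
    using \<open>P ** Q = mat 1\<close> \<open>Q ** P = mat 1\<close> unfolding matrix_inv_def
    by (rule someI2[where a = Q, OF conjI]) simp
  ultimately have "matrix_inv P = Q"
    by (metis matrix_mul_assoc matrix_mul_lid matrix_mul_rid)
  then show "matrix_inv P $ 1 $ 1 = P$2$2 / N" "matrix_inv P $ 1 $ 2 = - P$1$2 / N"
    "matrix_inv P $ 2 $ 1 = - P$2$1 / N" "matrix_inv P $ 2 $ 2 = P$1$1 / N"
    by (simp_all add: Q_def)
qed

text \<open>A toric structure at one point, with the symmetric and skew parts of \<open>\<Psi>\<close> as separate
  parameters.\<close>
locale toric_point =
  fixes P :: "real^2^2" and p q r c :: real and Gend J :: "gtan \<Rightarrow> gtan"
  assumes P: "P$1$1 = p" "P$1$2 = q + c" "P$2$1 = q - c" "P$2$2 = r"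
    and D: "p * r - q\<^sup>2 > 0" and c: "c \<noteq> 0"
    and GJ: "toric_structure P Gend J"
begin

abbreviation k :: real where "k \<equiv> 1 / (p * r - q\<^sup>2)"
abbreviation e :: real where "e \<equiv> 1 + c\<^sup>2 * k"

text \<open>The determinant of \<open>\<Psi>\<close>, which is positive together with \<open>det H\<close>.\<close>
definition N where "N = p * r - q\<^sup>2 + c\<^sup>2"

definition n where "n = 1 / N"

lemma N: "N > 0" using D by (simp add: N_def add_pos_nonneg)

lemma n: "n * (p * r - q\<^sup>2 + c\<^sup>2) = 1" using N by (simp add: n_def N_def)

lemma kD: "k * (p * r - q\<^sup>2) = 1"
  using D by auto

lemma det_P: "P$1$1 * P$2$2 - P$1$2 * P$2$1 = N"
  by (simp add: P N_def power2_eq_square algebra_simps)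

lemma inv_P: "matrix_inv P $ 1 $ 1 = r / N" "matrix_inv P $ 1 $ 2 = - (q + c) / N"
    "matrix_inv P $ 2 $ 1 = - (q - c) / N" "matrix_inv P $ 2 $ 2 = p / N"
  using matrix_inv_2x2[of P, unfolded det_P, unfolded P] N by auto

lemma Jplus_eq: "Jplus P X = vec4 (p * X$3 + (q + c) * X$4) ((q - c) * X$3 + r * X$4)
    (- n * (r * X$1 - (q + c) * X$2)) (- n * (p * X$2 - (q - c) * X$1))"
  by (simp add: Jplus_def vec4_eq_iff sum_2 del_t_def del_mu_def axis_def P inv_P n_def
      diff_divide_distrib add_divide_distrib algebra_simps)

lemma Jminus_eq: "Jminus P X = vec4 (p * X$3 + (q - c) * X$4) ((q + c) * X$3 + r * X$4)
    (- n * (r * X$1 - (q - c) * X$2)) (- n * (p * X$2 - (q + c) * X$1))"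
  by (simp add: Jminus_def vec4_eq_iff sum_2 del_t_def del_mu_def axis_def P inv_P n_def
      diff_divide_distrib add_divide_distrib algebra_simps)

text \<open>So the two eigenbundles of the generalized metric are the graphs of \<open>- \<omega> \<circ> J\<^sub>+\<close> and \<open>\<omega> \<circ> J\<^sub>-\<close>,
  the form in which all computations with them are done.\<close>
lemma plus_graph: "bmap P X + gmap P X = - omega_map (Jplus P X)"
  and minus_graph: "bmap P X - gmap P X = omega_map (Jminus P X)"
  by (simp_all add: bmap_def gmap_def omega_map_eq vec4_eq_iff field_simps)

text \<open>The two graphs span because \<open>g\<close> is invertible: \<open>X + \<xi>\<close> is the sum of the elements over
  \<open>(X \<plusminus> W) / 2\<close> with \<open>W = g\<inverse> (\<xi> - b X)\<close>.  This reduces every identity between endomorphisms to the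
  two graphs, where the defining conditions apply.\<close>
lemma structure_unique:
  assumes "linear A" "linear B"
    and "\<And>X. A (X, bmap P X + gmap P X) = B (X, bmap P X + gmap P X)"
    and "\<And>X. A (X, bmap P X - gmap P X) = B (X, bmap P X - gmap P X)"
  shows "A = B"
proof
  fix u :: gtan
  obtain X \<xi> where u: "u = (X, \<xi>)" by force
  \<comment> \<open>\<open>\<eta> = \<xi> - b X\<close> and \<open>W = g\<inverse> \<eta>\<close>, written out\<close>
  define \<eta> where "\<eta> = \<xi> - vec4 (- n * c * X$2) (n * c * X$1) (c * X$4) (- c * X$3)"
  define W where "W = vec4 (N * k * (p * \<eta>$1 + q * \<eta>$2)) (N * k * (q * \<eta>$1 + r * \<eta>$2))
      (k * (r * \<eta>$3 - q * \<eta>$4)) (k * (p * \<eta>$4 - q * \<eta>$3))"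
  define U where "U = (1/2) *\<^sub>R (X + W)"
  define V where "V = (1/2) *\<^sub>R (X - W)"
  have bX: "bmap P Y = vec4 (- n * c * Y$2) (n * c * Y$1) (c * Y$4) (- c * Y$3)" for Y
    by (simp add: bmap_def omega_map_eq Jplus_eq Jminus_eq vec4_eq_iff field_simps)
  have gX: "gmap P Y = vec4 (n * (r * Y$1 - q * Y$2)) (n * (p * Y$2 - q * Y$1))
      (p * Y$3 + q * Y$4) (q * Y$3 + r * Y$4)" for Y
    by (simp add: gmap_def omega_map_eq Jplus_eq Jminus_eq vec4_eq_iff field_simps)
  have gW: "gmap P W = \<eta>"
  proof -
    define k' where "k' = k"
    have k': "k' * (p * r - q\<^sup>2) = 1" using kD by (simp add: k'_def)
    show ?thesis
      unfolding gX vec4_eq_iff W_def vec4_nth k'_def[symmetric] N_def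
      by (intro conjI) (use n k' in algebra)+
  qed
  have "(X, \<xi>) = (U, bmap P U + gmap P U) + (V, bmap P V - gmap P V)"
  proof -
    have "bmap P U + bmap P V = bmap P X" by (simp add: bX U_def V_def vec4_eq_iff field_simps)
    moreover have "gmap P U - gmap P V = gmap P W" by (simp add: gX U_def V_def vec4_eq_iff field_simps)
    moreover have "U + V = X" by (simp add: U_def V_def vec_eq_iff field_simps)
    moreover have "bmap P X + gmap P W = \<xi>" by (simp add: gW \<eta>_def bX)
    moreover have "bmap P U + gmap P U + (bmap P V - gmap P V)
        = (bmap P U + bmap P V) + (gmap P U - gmap P V)" by simp
    ultimately show ?thesis by (simp add: prod_eq_iff)
  qed
  then show "A u = B u"
    unfolding u by (simp only: linear_add[OF assms(1)] linear_add[OF assms(2)] assms(3,4))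
qed

lemma Jplus_Jplus: "Jplus P (Jplus P X) = - X"
  unfolding Jplus_eq vec4_eq_iff vec4_nth uminus_vec_def vec_lambda_beta
  by (intro conjI) (use n in algebra)+

lemma Jminus_Jminus: "Jminus P (Jminus P X) = - X"
  unfolding Jminus_eq vec4_eq_iff vec4_nth uminus_vec_def vec_lambda_beta
  by (intro conjI) (use n in algebra)+

lemma omega_map_minus: "omega_map (- X) = - omega_map X"
  by (simp add: omega_map_eq vec4_eq_iff)

lemma J_plus: "J (X, - omega_map (Jplus P X)) = (Jplus P X, omega_map X)"
  and J_minus: "J (X, omega_map (Jminus P X)) = (Jminus P X, - omega_map X)"
  and Gend_plus: "Gend (X, - omega_map (Jplus P X)) = (X, - omega_map (Jplus P X))"
  and Gend_minus: "Gend (X, omega_map (Jminus P X)) = - (X, omega_map (Jminus P X))"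
  using GJ by (simp_all add: toric_structure_def plus_graph minus_graph Jplus_Jplus Jminus_Jminus
      omega_map_minus)

lemma linear_Gend: "linear Gend" and linear_J: "linear J"
  using GJ by (simp_all add: toric_structure_def)

text \<open>\<open>J\<close> preserves each graph: its value is again the graph element over the vector part.\<close>
lemma J_graph_image:
  "(Jplus P X, omega_map X) = (Jplus P X, - omega_map (Jplus P (Jplus P X)))"
  "(Jminus P X, - omega_map X) = (Jminus P X, omega_map (Jminus P (Jminus P X)))"
  by (simp_all add: Jplus_Jplus Jminus_Jminus omega_map_minus)

lemma J_squared: "J \<circ> J = uminus"
proof (rule structure_unique)
  show "linear (J \<circ> J)" by (rule linear_compose[OF linear_J linear_J])
  show "linear (uminus :: gtan \<Rightarrow> gtan)" by (rule linearI) simp_all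
  show "(J \<circ> J) (X, bmap P X + gmap P X) = - (X, bmap P X + gmap P X)" for X
    unfolding plus_graph comp_def J_plus unfolding J_graph_image(1) unfolding J_plus
    by (simp add: Jplus_Jplus)
  show "(J \<circ> J) (X, bmap P X - gmap P X) = - (X, bmap P X - gmap P X)" for X
    unfolding minus_graph comp_def J_minus unfolding J_graph_image(2) unfolding J_minus
    by (simp add: Jminus_Jminus)
qed

lemma J_eq: "J = toric_J p q r c k e"
proof (rule structure_unique)
  show "linear J" by (rule linear_J)
  define k' where "k' = k"
  have k': "k' * (p * r - q\<^sup>2) = 1" using kD by (simp add: k'_def)
  show "J (X, bmap P X + gmap P X) = toric_J p q r c k e (X, bmap P X + gmap P X)" for X
    unfolding plus_graph J_plus unfolding Jplus_eq toric_J_def k'_def[symmetric] Let_def omega_map_eq prod_eq_iff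
      vec4_eq_iff fst_conv snd_conv vec4_nth uminus_vec_def vec_lambda_beta
    by (intro conjI) (use n k' in algebra)+
  show "J (X, bmap P X - gmap P X) = toric_J p q r c k e (X, bmap P X - gmap P X)" for X
    unfolding minus_graph J_minus unfolding Jminus_eq toric_J_def k'_def[symmetric] Let_def omega_map_eq prod_eq_iff
      vec4_eq_iff fst_conv snd_conv vec4_nth uminus_vec_def vec_lambda_beta
    by (intro conjI) (use n k' in algebra)+
qed (rule linear_toric_J)

lemma Gend_J_eq: "Gend \<circ> J = omega_J"
proof (rule structure_unique)
  show "linear (Gend \<circ> J)" by (rule linear_compose[OF linear_J linear_Gend])
  show "(Gend \<circ> J) (X, bmap P X + gmap P X) = omega_J (X, bmap P X + gmap P X)" for X
    unfolding plus_graph comp_def J_plus unfolding J_graph_image(1) Gend_plus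
    by (simp add: Jplus_Jplus omega_map_minus omega_J_def omega_map_eq vec4_eq_iff)
  show "(Gend \<circ> J) (X, bmap P X - gmap P X) = omega_J (X, bmap P X - gmap P X)" for X
    unfolding minus_graph comp_def J_minus unfolding J_graph_image(2) Gend_minus
    by (simp add: Jminus_Jminus omega_map_minus omega_J_def omega_map_eq vec4_eq_iff)
qed (rule linear_omega_J)

abbreviation x0 :: gtan where "x0 \<equiv> (- del_t 1, 0)"

lemma x0_eq: "x0 = (vec4 (- 1) 0 0 0, 0)"
  by (simp add: del_t_def vec4_eq_iff axis_def)

lemma J_x0: "J x0 = (vec4 0 0 (k * r) (- k * q), vec4 0 0 (- c * k * q) (- c * k * r))"
  by (simp add: J_eq x0_eq toric_J_def prod_eq_iff vec4_eq_iff)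

lemma J2_x0: "(Gend \<circ> J) x0 = (0, vec4 0 0 1 0)"
  by (simp add: Gend_J_eq x0_eq omega_J_def prod_eq_iff vec4_eq_iff)

lemma J3_x0: "J ((Gend \<circ> J) x0) = (vec4 (- c * k * q) (- c * k * r) 0 0, vec4 (k * r) (- k * q) 0 0)"
  unfolding J2_x0 by (simp add: J_eq toric_J_def prod_eq_iff vec4_eq_iff)

lemma Gend_x0: "Gend x0 = (vec4 (c * k * q) (c * k * r) 0 0, vec4 (- k * r) (k * q) 0 0)"
proof -
  have "Gend x0 = - (Gend \<circ> J) (J x0)"
    using fun_cong[OF J_squared, of x0] linear_neg[OF linear_Gend, of x0] by (simp only: comp_apply) simp
  also have "\<dots> = (vec4 (c * k * q) (c * k * r) 0 0, vec4 (- k * r) (k * q) 0 0)"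
    unfolding Gend_J_eq J_x0 by (simp add: omega_J_def prod_eq_iff vec4_eq_iff)
  finally show ?thesis .
qed

lemma GX0: "pairing (Gend x0) x0 = k * r / 2"
  unfolding Gend_x0 by (simp add: pairing_def ev_eq x0_eq)

text \<open>Orthogonality to \<open>x\<^sub>0\<close> and to \<open>J\<^sub>2 x\<^sub>0 = d\<mu>\<^sub>1\<close> gives the two vanishing components, orthogonality to
  \<open>J\<^sub>1 x\<^sub>0\<close> and \<open>J\<^sub>3 x\<^sub>0\<close> the two linear relations.\<close>
lemma S_perp_iff: "(\<forall>w \<in> span {x0, J x0, (Gend \<circ> J) x0, J ((Gend \<circ> J) x0)}. pairing u w = 0)
    \<longleftrightarrow> snd u $ 1 = 0 \<and> fst u $ 3 = 0 \<and> r * snd u $ 3 = q * snd u $ 4 + c * r * fst u $ 4 \<and>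
      r * fst u $ 1 = q * fst u $ 2 + c * r * snd u $ 2"
    (is "?L \<longleftrightarrow> ?R")
proof -
  define B where "B = {x0, J x0, (Gend \<circ> J) x0, J ((Gend \<circ> J) x0)}"
  have "subspace {w. pairing u w = 0}"
    by (rule subspaceI) (simp_all add: pairing_add pairing_scaleR, simp add: pairing_def ev_eq)
  then have "?L \<longleftrightarrow> (\<forall>w\<in>B. pairing u w = 0)"
    unfolding B_def[symmetric]
    using span_minimal[of B "{w. pairing u w = 0}"] span_superset[of B] by blast
  also have "\<dots> \<longleftrightarrow> snd u $ 1 = 0 \<and> fst u $ 3 = 0 \<and>
      k * (r * snd u $ 3 - q * snd u $ 4 - c * q * fst u $ 3 - c * r * fst u $ 4) = 0 \<and>
      k * (r * fst u $ 1 - q * fst u $ 2 - c * q * snd u $ 1 - c * r * snd u $ 2) = 0"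
    unfolding B_def J3_x0 unfolding J2_x0 J_x0 unfolding x0_eq
    by (auto simp: pairing_def ev_eq algebra_simps)
  also have "\<dots> \<longleftrightarrow> ?R"
    using D by auto
  finally show ?thesis .
qed

lemma S_perpC_iff:
  "u \<in> cx_sub {u. \<forall>w \<in> span {x0, J x0, (Gend \<circ> J) x0, J ((Gend \<circ> J) x0)}. pairing u w = 0}
    \<longleftrightarrow> snd u $ 1 = 0 \<and> fst u $ 3 = 0
      \<and> of_real r * snd u $ 3 = of_real q * snd u $ 4 + of_real c * of_real r * fst u $ 4
      \<and> of_real r * fst u $ 1 = of_real q * fst u $ 2 + of_real c * of_real r * snd u $ 2"
  unfolding cx_sub_def S_perp_iff
  by (auto simp: gRe_def gIm_def vRe_def vIm_def complex_eq_iff)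

lemma L1_eq: "eigen10 J = {(X, \<xi>). \<xi> = eps1_map (of_real p) (of_real q) (of_real r) (of_real c) X}"
proof -
  have "of_real k * (of_real p * of_real r - (of_real q)\<^sup>2) = (1::complex)"
    unfolding of_real_mult[symmetric] of_real_power[symmetric] of_real_diff[symmetric] kD by simp
  from toric_J_eigen_iff[OF _ this refl] c show ?thesis
    by (auto simp: eigen10_def J_eq cx_endo_toric_J)
qed

end

section \<open>Derivatives along complex tangent vectors\<close>

lemma vcx_simps [simp]: "vRe (vcx X) = X" "vIm (vcx X) = 0" "vcx X $ k = of_real (X $ k)"
  by (simp_all add: vRe_def vIm_def vcx_def vec_eq_iff)

lemma vRe_vIm_nth [simp]: "vRe X $ k = Re (X $ k)" "vIm X $ k = Im (X $ k)"
  by (simp_all add: vRe_def vIm_def)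

lemma cdir_eq: "(\<phi> has_derivative D) (at x) \<Longrightarrow> cdir \<phi> x X = D (vRe X) + \<i> * D (vIm X)"
  by (simp add: cdir_def frechet_derivative_eqI)

lemma cdir_cong:
  assumes "open S" "x \<in> S" "\<And>y. y \<in> S \<Longrightarrow> \<phi> y = \<psi> y"
  shows "cdir \<phi> x X = cdir \<psi> x X"
  using frechet_derivative_cong_open[OF assms] by (simp add: cdir_def)

lemma cdir_const [simp]: "cdir (\<lambda>x. z) x X = 0"
  by (simp add: cdir_def)

lemma cdir_mult:
  assumes "\<phi> differentiable at x" "\<psi> differentiable at x"
  shows "cdir (\<lambda>y. \<phi> y * \<psi> y) x X = cdir \<phi> x X * \<psi> x + \<phi> x * cdir \<psi> x X"
proof -
  note D = assms[unfolded frechet_derivative_works]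
  show ?thesis
    unfolding cdir_eq[OF has_derivative_mult[OF D]] by (simp add: cdir_def algebra_simps)
qed

lemma cdir_add:
  assumes "\<phi> differentiable at x" "\<psi> differentiable at x"
  shows "cdir (\<lambda>y. \<phi> y + \<psi> y) x X = cdir \<phi> x X + cdir \<psi> x X"
proof -
  note D = assms[unfolded frechet_derivative_works]
  show ?thesis
    unfolding cdir_eq[OF has_derivative_add[OF D]] by (simp add: cdir_def algebra_simps)
qed

lemma cdir_diff:
  assumes "\<phi> differentiable at x" "\<psi> differentiable at x"
  shows "cdir (\<lambda>y. \<phi> y - \<psi> y) x X = cdir \<phi> x X - cdir \<psi> x X"
proof -
  note D = assms[unfolded frechet_derivative_works]
  show ?thesis
    unfolding cdir_eq[OF has_derivative_diff[OF D]] by (simp add: cdir_def algebra_simps)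
qed

lemma cdiff_eq:
  assumes "(\<phi> has_derivative D) (at x)"
  shows "cdiff \<phi> x X = of_real (D (vRe X)) + \<i> * of_real (D (vIm X))"
  unfolding cdiff_def by (rule cdir_eq) (rule has_derivative_of_real[OF assms])

lemma cdiff_cong:
  assumes "open S" "x \<in> S" "\<And>y. y \<in> S \<Longrightarrow> \<phi> y = \<psi> y"
  shows "cdiff \<phi> x X = cdiff \<psi> x X"
  unfolding cdiff_def using assms by (intro cdir_cong[of S]) auto

text \<open>Used for functions of some of the coordinates only, in directions that leave these
  coordinates fixed.\<close>
lemma derivative_along_constant:
  assumes "(\<phi> has_derivative D) (at x)" "\<And>t. \<phi> (x + t *\<^sub>R V) = \<phi> x"
  shows "D V = 0"
proof -
  have "((\<lambda>t. x + t *\<^sub>R V) has_derivative (\<lambda>t. t *\<^sub>R V)) (at (0::real))"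
    by (auto intro!: derivative_eq_intros)
  moreover have "(\<phi> has_derivative D) (at (x + 0 *\<^sub>R V))" using assms(1) by simp
  ultimately have "((\<lambda>t. \<phi> (x + t *\<^sub>R V)) has_derivative (\<lambda>t. D (t *\<^sub>R V))) (at 0)"
    by (rule has_derivative_compose)
  then have "((\<lambda>t::real. \<phi> x) has_derivative (\<lambda>t. D (t *\<^sub>R V))) (at 0)"
    by (simp only: assms(2))
  from has_derivative_unique[OF this has_derivative_const] show ?thesis
    by (metis scaleR_one)
qed

text \<open>Up to a vector with \<open>d\<mu>\<^sub>1 = 0\<close>, on which \<open>D\<close> vanishes, \<open>V\<close> is a multiple of \<open>\<partial>\<mu>\<^sub>1\<close>.\<close>
lemma derivative_third:
  assumes "(\<phi> has_derivative D) (at (x :: real^4))" "\<And>V. V $ 3 = 0 \<Longrightarrow> D V = (0 :: real)"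
  shows "D V = V $ 3 * D (axis 3 1)"
proof -
  have lin: "linear D" by (rule has_derivative_linear[OF assms(1)])
  have "D V = D (V - (V $ 3) *\<^sub>R axis 3 1) + D ((V $ 3) *\<^sub>R axis 3 1)"
    by (simp flip: linear_add[OF lin])
  also have "D (V - (V $ 3) *\<^sub>R axis 3 1) = 0" by (rule assms(2)) (simp add: axis_def)
  finally show ?thesis by (simp add: linear_scale[OF lin])
qed

lemma linear_mu: "linear mu"
  by (rule linearI) (simp_all add: vec_eq_iff forall_2)

lemma mu_eq_iff: "mu x = mu y \<longleftrightarrow> x $ 3 = y $ 3 \<and> x $ 4 = y $ 4"
  by (simp add: vec_eq_iff forall_2)

lemma open_mu_image: "open S \<Longrightarrow> open (mu ` S)"
proof (rule open_surjective_linear_image[OF _ linear_mu])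
  have "v = mu (vec4 0 0 (v $ 1) (v $ 2))" for v
    by (simp add: vec_eq_iff forall_2)
  then show "surj mu" by blast
qed

section \<open>The functions of the toric twist data\<close>

locale toric_twist =
  fixes M :: "(real^4) set"
    and \<tau> :: "real^2 \<Rightarrow> real" and C :: "real^2^2"
    and Gend J :: "real^4 \<Rightarrow> gtan \<Rightarrow> gtan"
    and h :: "real \<Rightarrow> real" and lam k0 :: real
    and X0 :: "real^4 \<Rightarrow> real^4"
    and F :: "real^4 \<Rightarrow> real^4 \<Rightarrow> real^4 \<Rightarrow> real"
    and f a :: "real^4 \<Rightarrow> real"
  assumes M: "open M"
    and tau: "smooth_on (mu ` M) \<tau>"
      "\<forall>m \<in> mu ` M. \<forall>v. v \<noteq> 0 \<longrightarrow> v \<bullet> (hessian \<tau> m *v v) > 0"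
    and C: "transpose C = - C" "C $ 1 $ 2 \<noteq> 0"
    and GJ: "\<forall>p\<in>M. toric_structure (Psi \<tau> C (mu p)) (Gend p) (J p)"
    and Psi: "\<forall>m \<in> mu ` M. partial_deriv 2 (\<lambda>m. Psi12s \<tau> C m / Psi \<tau> C m $ 2 $ 2) m = 0"
    and h: "smooth_on ((\<lambda>p. mu p $ 1) ` M) h"
      "\<forall>x \<in> (\<lambda>p. mu p $ 1) ` M. h x \<noteq> 0 \<and> deriv h x \<noteq> 0"
    and nonzero: "lam \<noteq> 0" "k0 \<noteq> 0"
    and ratio: "\<forall>x \<in> (\<lambda>p. mu p $ 1) ` M.
      lam * h x ^ 3 / (k0 * deriv h x) < 0 \<and> lam * h x ^ 3 / (k0 * deriv h x) \<noteq> -2"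
    and X0: "X0 = (\<lambda>p. - del_t 1)"
    and a: "a = (\<lambda>p. k0 / (h (mu p $ 1))\<^sup>2)"
    and f: "\<forall>p\<in>M. (f p)\<^sup>2 = - (lam * h (mu p $ 1) ^ 3 / (2 * k0 * deriv h (mu p $ 1)))"
    and F: "F = (\<lambda>p X Y.
      2 * a p * deriv h (mu p $ 1) / h (mu p $ 1) * wedge11 (dmu 1) (dt 1) X Y
      + wedge11 (\<lambda>V. Psi12s \<tau> C (mu p) / Psi \<tau> C (mu p) $ 2 $ 2
              * (lam - 2 * a p * deriv h (mu p $ 1) / h (mu p $ 1)) * dmu 1 V
            + lam * dmu 2 V) (dt 2) X Y)"
begin

sublocale twist_data M Gend J X0 F f a "\<lambda>p. h (mu p $ 1)" .

abbreviation c where "c \<equiv> C $ 1 $ 2"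
definition H11 where "H11 x = hessian \<tau> (mu x) $ 1 $ 1"
definition H12 where "H12 x = hessian \<tau> (mu x) $ 1 $ 2"
definition H22 where "H22 x = hessian \<tau> (mu x) $ 2 $ 2"
definition inv_det where "inv_det x = 1 / (H11 x * H22 x - (H12 x)\<^sup>2)"
text \<open>Twice \<open>G(X\<^sub>0, X\<^sub>0)\<close>.\<close>
definition rho where "rho x = inv_det x * H22 x"
definition psi where "psi x = Psi12s \<tau> C (mu x) / Psi \<tau> C (mu x) $ 2 $ 2"
definition h_mu where "h_mu x = h (x $ 3)"
definition dh_mu where "dh_mu x = deriv h (x $ 3)"
text \<open>\<open>\<kappa> = 2 a h' / h\<close>, and \<open>\<phi>\<close> is \<open>f\<^sup>2\<close> on \<open>M\<close>.  Unlike \<open>f\<^sup>2\<close>, both are functions of \<open>\<mu>\<^sub>1\<close> on the whole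
  space, so \<open>derivative_along_constant\<close> applies to them.\<close>
definition kappa where "kappa x = 2 * k0 * dh_mu x / h_mu x ^ 3"
definition phi where "phi x = - lam / kappa x"

lemma C_entries: "C $ 1 $ 1 = 0" "C $ 2 $ 2 = 0" "C $ 2 $ 1 = - c"
proof -
  have "C $ j $ i = - C $ i $ j" for i j
    using arg_cong[OF C(1), of "\<lambda>A. A $ i $ j"] by (simp add: transpose_def)
  from this[of 1 1] this[of 2 2] this[of 2 1]
  show "C $ 1 $ 1 = 0" "C $ 2 $ 2 = 0" "C $ 2 $ 1 = - c" by simp_all
qed

lemma mu_in: "x \<in> M \<Longrightarrow> mu x \<in> mu ` M"
  by (rule imageI)

lemma smooth_hessian_entry: "smooth_on (mu ` M) (\<lambda>m. hessian \<tau> m $ i $ j)"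
  unfolding hessian_def partial_deriv_def[abs_def]
  by simp (intro smooth_on_frechet_derivative tau)

lemma hessian_sym: "x \<in> M \<Longrightarrow> hessian \<tau> (mu x) $ 2 $ 1 = H12 x"
  using frechet_derivative_commute[OF open_mu_image[OF M] mu_in, of x \<tau> "axis 1 1" "axis 2 1"] tau(1)
  by (simp add: H12_def hessian_def partial_deriv_def[abs_def] smooth_on_def del: k_smooth_on.simps)

lemma smooth_entries: "smooth_on M H11" "smooth_on M H12" "smooth_on M H22"
  unfolding H11_def[abs_def] H12_def[abs_def] H22_def[abs_def]
  using linear_mu M smooth_hessian_entry
  by (auto intro!: smooth_on_linear_comp[where L = mu] simp: linear_conv_bounded_linear[symmetric])

lemma H22_pos: assumes "x \<in> M" shows "H22 x > 0"
proof -
  have "axis 2 1 \<noteq> (0 :: real^2)" by (simp add: axis_eq_0_iff)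
  then have "axis 2 1 \<bullet> (hessian \<tau> (mu x) *v axis 2 1) > 0"
    using tau(2) mu_in[OF assms] by blast
  then show ?thesis
    by (simp add: inner_vec_def sum_2 matrix_vector_mult_def axis_def H22_def)
qed

text \<open>The quadratic form of the Hessian takes the value \<open>r det H\<close> at \<open>(r, -q)\<close>.\<close>
lemma det_pos: assumes "x \<in> M" shows "H11 x * H22 x - (H12 x)\<^sup>2 > 0"
proof -
  define v :: "real^2" where "v = (\<chi> i. if i = 1 then H22 x else - H12 x)"
  have "v \<noteq> 0" using H22_pos[OF assms] by (auto simp: v_def vec_eq_iff forall_2)
  then have "v \<bullet> (hessian \<tau> (mu x) *v v) > 0"
    using tau(2) mu_in[OF assms] by blast
  also have "v \<bullet> (hessian \<tau> (mu x) *v v) = H22 x * (H11 x * H22 x - (H12 x)\<^sup>2)"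
    by (simp add: inner_vec_def sum_2 matrix_vector_mult_def v_def hessian_sym[OF assms]
        flip: H11_def H12_def H22_def) (simp add: power2_eq_square algebra_simps)
  finally show ?thesis using H22_pos[OF assms] by (simp add: zero_less_mult_iff)
qed

lemma point: "x \<in> M \<Longrightarrow> toric_point (Psi \<tau> C (mu x)) (H11 x) (H12 x) (H22 x) c (Gend x) (J x)"
  using GJ C(2) det_pos
  by unfold_locales (auto simp: Psi_def C_entries hessian_sym simp flip: H11_def H12_def H22_def)

lemma psi_eq: "x \<in> M \<Longrightarrow> psi x = H12 x / H22 x"
  by (simp add: psi_def Psi12s_def Psi_def C_entries hessian_sym flip: H12_def H22_def)

lemma psi_H22: "x \<in> M \<Longrightarrow> psi x * H22 x = H12 x"
  using H22_pos[of x] by (simp add: psi_eq)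

lemma rho_pos: "x \<in> M \<Longrightarrow> rho x > 0"
  using H22_pos[of x] det_pos[of x] by (simp add: rho_def inv_det_def)

lemma inv_det_H12: "x \<in> M \<Longrightarrow> inv_det x * H12 x = rho x * psi x"
  by (simp add: rho_def psi_H22[symmetric])

lemma h_nonzero: assumes "x \<in> M" shows "h_mu x \<noteq> 0" "dh_mu x \<noteq> 0" "kappa x \<noteq> 0"
proof -
  show 1: "h_mu x \<noteq> 0" "dh_mu x \<noteq> 0" using h(2) assms by (auto simp: h_mu_def dh_mu_def)
  then show "kappa x \<noteq> 0" using nonzero by (simp add: kappa_def)
qed

lemma f_sq: "x \<in> M \<Longrightarrow> (f x)\<^sup>2 = phi x"
  using f by (simp add: phi_def kappa_def h_mu_def dh_mu_def)

lemma phi: assumes "x \<in> M" shows "phi x > 0" "phi x \<noteq> 1" "lam = - kappa x * phi x"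
proof -
  define t where "t = lam * h_mu x ^ 3 / (k0 * dh_mu x)"
  have "t < 0 \<and> t \<noteq> - 2" using ratio assms by (auto simp: t_def h_mu_def dh_mu_def)
  moreover have "phi x = - t / 2" by (simp add: t_def phi_def kappa_def)
  ultimately show "phi x > 0" "phi x \<noteq> 1" by auto
  show "lam = - kappa x * phi x" using h_nonzero[OF assms] by (simp add: phi_def)
qed

lemma smooth_rho: "smooth_on M rho"
  unfolding rho_def[abs_def] inv_det_def
  using smooth_entries M det_pos
  by (intro smooth_on_mult smooth_on_divide smooth_on_const smooth_on_diff)
     (auto simp: power2_eq_square intro!: smooth_on_mult, fastforce simp: power2_eq_square)

lemma smooth_psi: "smooth_on M psi"
proof (rule smooth_on_cong[OF M])
  show "smooth_on M (\<lambda>x. H12 x / H22 x)"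
    using smooth_entries M H22_pos by (intro smooth_on_divide) fastforce+
qed (simp add: psi_eq)

lemma h_differentiable: "x \<in> M \<Longrightarrow> h differentiable (at (x $ 3))"
  by (rule smooth_on_differentiable[OF h(1)]) auto

lemma h_mu_has_derivative:
  assumes "x \<in> M" shows "(h_mu has_derivative (\<lambda>V. dh_mu x * V $ 3)) (at x)"
proof -
  have 1: "((\<lambda>x :: real^4. x $ 3) has_derivative (\<lambda>V. V $ 3)) (at x)"
    by (intro bounded_linear_imp_has_derivative bounded_linear_vec_nth)
  have "(h has_derivative (\<lambda>t. dh_mu x * t)) (at (x $ 3))"
    using h_differentiable[OF assms]
    unfolding dh_mu_def has_field_derivative_def[symmetric]
    by (simp add: DERIV_deriv_iff_real_differentiable)
  from has_derivative_compose[OF 1 this] show ?thesis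
    unfolding h_mu_def[abs_def] .
qed

lemma smooth_h_mu: "smooth_on M h_mu"
  unfolding h_mu_def[abs_def]
  using smooth_on_linear_comp[where L = "\<lambda>x. x $ 3", OF bounded_linear_vec_nth M, of h] h(1) by simp

lemma smooth_dh_mu: "smooth_on M dh_mu"
proof (rule smooth_on_cong[OF M])
  have "smooth_on ((\<lambda>x. x $ 3) ` M) (\<lambda>t. frechet_derivative h (at t) 1)"
    using smooth_on_frechet_derivative[OF h(1)] by simp
  then show "smooth_on M (\<lambda>x. frechet_derivative h (at (x $ 3)) 1)"
    by (rule smooth_on_linear_comp[where L = "\<lambda>x. x $ 3", OF bounded_linear_vec_nth M])
  show "frechet_derivative h (at (x $ 3)) 1 = dh_mu x" if "x \<in> M" for x
    using h_differentiable[OF that] DERIV_deriv_iff_real_differentiable[of h "x $ 3"]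
    by (simp add: dh_mu_def has_field_derivative_def frechet_derivative_eqI)
qed

lemma smooth_kappa: "smooth_on M kappa"
  unfolding kappa_def[abs_def]
  using M smooth_h_mu smooth_dh_mu h_nonzero
  by (intro smooth_on_divide smooth_on_mult smooth_on_const)
     (auto simp: power3_eq_cube intro!: smooth_on_mult)

lemma smooth_phi: "smooth_on M phi"
  unfolding phi_def[abs_def]
  using M smooth_kappa h_nonzero by (intro smooth_on_divide smooth_on_const) auto

lemma derivative_zero_of_third:
  assumes "x \<in> M" "V $ 3 = 0"
  shows "frechet_derivative phi (at x) V = 0" "frechet_derivative kappa (at x) V = 0"
  by (rule derivative_along_constant[OF smooth_on_has_derivative[OF smooth_phi assms(1)]]
      derivative_along_constant[OF smooth_on_has_derivative[OF smooth_kappa assms(1)]],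
      simp add: phi_def kappa_def h_mu_def dh_mu_def assms(2))+

text \<open>Modulo the \<open>t\<close>-directions, which do not affect \<open>\<psi>\<close>, the vector is a multiple of \<open>\<partial>\<mu>\<^sub>2\<close>; this is where
  the hypothesis on \<open>\<Psi>\<close> enters.\<close>
lemma psi_derivative:
  assumes "x \<in> M" "V $ 3 = 0"
  shows "frechet_derivative psi (at x) V = 0"
proof -
  define g where "g = (\<lambda>m. Psi12s \<tau> C m / Psi \<tau> C m $ 2 $ 2)"
  have H: "(\<lambda>m. hessian \<tau> m $ i $ j) differentiable (at (mu x))" for i j
    by (rule smooth_on_differentiable[OF smooth_hessian_entry mu_in[OF assms(1)]])
  have "g differentiable (at (mu x))"
    unfolding g_def Psi12s_def Psi_def using H22_pos[OF assms(1)]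
    by (auto intro!: differentiable_divide differentiable_add H simp: C_entries simp flip: H22_def)
  then have g: "(g has_derivative frechet_derivative g (at (mu x))) (at (mu x))"
    by (simp add: frechet_derivative_works)
  have "bounded_linear mu" using linear_mu by (simp add: linear_conv_bounded_linear)
  from has_derivative_compose[OF bounded_linear_imp_has_derivative[OF this] g]
  have "frechet_derivative psi (at x) V = frechet_derivative g (at (mu x)) (mu V)"
    unfolding g_def psi_def[abs_def] by (rule frechet_derivative_eqI)
  also have "mu V = V $ 4 *\<^sub>R axis 2 1"
    using assms(2) by (simp add: vec_eq_iff forall_2 axis_def)
  also have "frechet_derivative g (at (mu x)) (V $ 4 *\<^sub>R axis 2 1) = 0"
  proof -
    have "partial_deriv 2 g (mu x) = 0"
      unfolding g_def using Psi mu_in[OF assms(1)] by blast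
    then show ?thesis
      using linear_scale[OF has_derivative_linear[OF g]] by (simp add: partial_deriv_def)
  qed
  finally show ?thesis .
qed

lemma x0_eq: "x0 x = (- del_t 1, 0)"
  by (simp add: x0_def) (simp add: X0)

lemma J_x0: "x \<in> M \<Longrightarrow> J1 x (x0 x) = (vec4 0 0 (rho x) (- rho x * psi x),
    vec4 0 0 (- c * rho x * psi x) (- c * rho x))"
  using toric_point.J_x0[OF point, of x] inv_det_H12[of x]
  by (simp add: J1_def x0_eq prod_eq_iff vec4_eq_iff rho_def flip: inv_det_def)

lemma J2_x0: "x \<in> M \<Longrightarrow> J2 x (x0 x) = (0, vec4 0 0 1 0)"
  using toric_point.J2_x0[OF point, of x] by (simp add: J2_def x0_eq)

lemma J3_x0: "x \<in> M \<Longrightarrow> J3 x (x0 x) = (vec4 (- c * rho x * psi x) (- c * rho x) 0 0,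
    vec4 (rho x) (- rho x * psi x) 0 0)"
  using toric_point.J3_x0[OF point, of x] inv_det_H12[of x]
  by (simp add: J3_def J2_def J1_def x0_eq prod_eq_iff vec4_eq_iff rho_def flip: inv_det_def)

lemma GX0_eq: "x \<in> M \<Longrightarrow> GX0 x = rho x / 2"
  using toric_point.GX0[OF point, of x] by (simp add: GX0_def x0_eq rho_def inv_det_def)

lemma Z_eq: "x \<in> M \<Longrightarrow> Z x = vcx (vec4 (- c * rho x * psi x) (- c * rho x) 0 0)"
  by (simp add: Z_def J3_x0)

lemma S_perp_iff: "x \<in> M \<Longrightarrow> u \<in> S_perp x \<longleftrightarrow> snd u $ 1 = 0 \<and> fst u $ 3 = 0
    \<and> H22 x * snd u $ 3 = H12 x * snd u $ 4 + c * H22 x * fst u $ 4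
    \<and> H22 x * fst u $ 1 = H12 x * fst u $ 2 + c * H22 x * snd u $ 2"
  using toric_point.S_perp_iff[OF point, of x u]
  unfolding S_perp_def S_space_def x0_eq J3_def J2_def J1_def comp_apply mem_Collect_eq .

lemma S_perpC_iff: "x \<in> M \<Longrightarrow> u \<in> S_perpC x \<longleftrightarrow> snd u $ 1 = 0 \<and> fst u $ 3 = 0
    \<and> of_real (H22 x) * snd u $ 3 = of_real (H12 x) * snd u $ 4 + of_real c * of_real (H22 x) * fst u $ 4
    \<and> of_real (H22 x) * fst u $ 1 = of_real (H12 x) * fst u $ 2 + of_real c * of_real (H22 x) * snd u $ 2"
  using toric_point.S_perpC_iff[OF point, of x u]
  unfolding S_perpC_def S_perp_def S_space_def x0_eq J3_def J2_def J1_def comp_apply .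

lemma L1_eq: "x \<in> M \<Longrightarrow> L1 x
    = {(X, \<xi>). \<xi> = eps1_map (of_real (H11 x)) (of_real (H12 x)) (of_real (H22 x)) (of_real c) X}"
  using toric_point.L1_eq[OF point, of x] by (simp add: L1_def J1_def)

lemma L2_eq: "x \<in> M \<Longrightarrow> L2 x = {(X, \<xi>). \<xi> = (- \<i>) *s vec4 (X$3) (X$4) (- X$1) (- X$2)}"
  using toric_point.Gend_J_eq[OF point, of x] eigen_omega_J by (simp add: L2_def J2_def)

lemma cnj_L2_eq: "x \<in> M \<Longrightarrow> cnj_sub (L2 x) = {(X, \<xi>). \<xi> = \<i> *s vec4 (X$3) (X$4) (- X$1) (- X$2)}"
proof (intro equalityI subsetI)
  fix u :: gtanC assume x: "x \<in> M" and "u \<in> {(X, \<xi>). \<xi> = \<i> *s vec4 (X$3) (X$4) (- X$1) (- X$2)}"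
  then have "gcnj u \<in> L2 x"
    by (auto simp: L2_eq gcnj_def vec4_eq_iff)
  moreover have "u = gcnj (gcnj u)" by (simp add: gcnj_def prod_eq_iff vec_eq_iff)
  ultimately show "u \<in> cnj_sub (L2 x)" unfolding cnj_sub_def by blast
qed (auto simp: cnj_sub_def L2_eq gcnj_def vec4_eq_iff)

text \<open>The vector \<open>\<partial>\<mu>\<^sub>2 - i (q + b) \<partial>t\<^sub>1 - i r \<partial>t\<^sub>2\<close>.  For \<open>b = c\<close> it is a \<open>(1,0)\<close>-vector of \<open>J\<^sub>+\<close>, for
  \<open>b = - c\<close> one of \<open>J\<^sub>-\<close>.\<close>
definition frame :: "real \<Rightarrow> real^4 \<Rightarrow> complex^4"
  where "frame b x = vec4 (- \<i> * of_real (H12 x + b)) (- \<i> * of_real (H22 x)) 0 1"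

text \<open>An element of \<open>L\<^sub>1 \<inter> L\<^sub>2\<close> over \<open>X\<close> has its covector part given by both graph maps; with \<open>d\<mu>\<^sub>1(X) = 0\<close>
  their equality fixes the \<open>t\<close>-components of \<open>X\<close> in terms of its \<open>\<mu>\<^sub>2\<close>-component.\<close>
lemma T12_iff: assumes "x \<in> M" shows "X \<in> T12 x \<longleftrightarrow> X = X $ 4 *s frame c x"
proof
  have c: "complex_of_real c \<noteq> 0" using C(2) by simp
  {
    assume "X \<in> T12 x"
    then obtain \<xi> where \<xi>: "(X, \<xi>) \<in> L1 x" "(X, \<xi>) \<in> L2 x" "(X, \<xi>) \<in> S_perpC x"
      unfolding T12_def by auto
    then have 3: "X $ 3 = 0"
      and e: "eps1_map (of_real (H11 x)) (of_real (H12 x)) (of_real (H22 x)) (of_real c) X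
        = (- \<i>) *s vec4 (X$3) (X$4) (- X$1) (- X$2)"
      using assms by (auto simp: S_perpC_iff L1_eq L2_eq)
    from e have "- X$2 - \<i> * (of_real (H22 x) * X$4) = 0"
      "X$1 + \<i> * (of_real (H12 x) * X$4) = - \<i> * of_real c * X$4"
      using c 3 by (simp_all add: eps1_map_def vec4_eq_iff Let_def divide_eq_eq mult_ac)
    then have "X $ 1 = - \<i> * (of_real (H12 x) + of_real c) * X $ 4"
      "X $ 2 = - \<i> * of_real (H22 x) * X $ 4" by algebra+
    with 3 show "X = X $ 4 *s frame c x" by (simp add: frame_def vec4_eq_iff)
  }
  {
    assume X: "X = X $ 4 *s frame c x"
    then have X': "X $ 1 = - \<i> * (of_real (H12 x) + of_real c) * X $ 4"
      "X $ 2 = - \<i> * of_real (H22 x) * X $ 4" "X $ 3 = 0"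
      by (simp_all add: vec4_eq_iff frame_def)
    define \<xi> where "\<xi> = (- \<i>) *s vec4 (X$3) (X$4) (- X$1) (- X$2)"
    have "eps1_map (of_real (H11 x)) (of_real (H12 x)) (of_real (H22 x)) (of_real c) X = \<xi>"
      using c unfolding eps1_map_def \<xi>_def vec4_eq_iff Let_def
      by (simp add: X' field_simps)
    then have "(X, \<xi>) \<in> L1 x \<inter> L2 x \<inter> S_perpC x"
      using assms by (auto simp: S_perpC_iff L1_eq L2_eq \<xi>_def X' algebra_simps)
    then show "X \<in> T12 x" unfolding T12_def by force
  }
qed

lemma T12bar_iff: assumes "x \<in> M" shows "X \<in> T12bar x \<longleftrightarrow> X = X $ 4 *s frame (- c) x"
proof
  have c: "complex_of_real c \<noteq> 0" using C(2) by simp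
  {
    assume "X \<in> T12bar x"
    then obtain \<xi> where \<xi>: "(X, \<xi>) \<in> L1 x" "(X, \<xi>) \<in> cnj_sub (L2 x)" "(X, \<xi>) \<in> S_perpC x"
      unfolding T12bar_def by auto
    then have 3: "X $ 3 = 0"
      and e: "eps1_map (of_real (H11 x)) (of_real (H12 x)) (of_real (H22 x)) (of_real c) X
        = \<i> *s vec4 (X$3) (X$4) (- X$1) (- X$2)"
      using assms by (auto simp: S_perpC_iff L1_eq cnj_L2_eq)
    from e have "- X$2 - \<i> * (of_real (H22 x) * X$4) = 0"
      "X$1 + \<i> * (of_real (H12 x) * X$4) = \<i> * of_real c * X$4"
      using c 3 by (simp_all add: eps1_map_def vec4_eq_iff Let_def divide_eq_eq mult_ac)
    then have "X $ 1 = - \<i> * (of_real (H12 x) - of_real c) * X $ 4"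
      "X $ 2 = - \<i> * of_real (H22 x) * X $ 4" by algebra+
    with 3 show "X = X $ 4 *s frame (- c) x" by (simp add: frame_def vec4_eq_iff)
  }
  {
    assume X: "X = X $ 4 *s frame (- c) x"
    then have X': "X $ 1 = - \<i> * (of_real (H12 x) - of_real c) * X $ 4"
      "X $ 2 = - \<i> * of_real (H22 x) * X $ 4" "X $ 3 = 0"
      by (simp_all add: vec4_eq_iff frame_def)
    define \<xi> where "\<xi> = \<i> *s vec4 (X$3) (X$4) (- X$1) (- X$2)"
    have "eps1_map (of_real (H11 x)) (of_real (H12 x)) (of_real (H22 x)) (of_real c) X = \<xi>"
      using c unfolding eps1_map_def \<xi>_def vec4_eq_iff Let_def
      by (simp add: X' field_simps)
    then have "(X, \<xi>) \<in> L1 x \<inter> cnj_sub (L2 x) \<inter> S_perpC x"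
      using assms by (auto simp: S_perpC_iff L1_eq cnj_L2_eq \<xi>_def X' algebra_simps)
    then show "X \<in> T12bar x" unfolding T12bar_def by force
  }
qed

lemma T2_third:
  assumes "x \<in> M" "X \<in> T2 x" shows "X $ 3 = 0"
  using assms by (auto simp: T2_def S_perpC_iff)

lemma F_eq: "x \<in> M \<Longrightarrow> F x X Y = kappa x * (X$3 * Y$1 - Y$3 * X$1)
    + psi x * (lam - kappa x) * (X$3 * Y$2 - Y$3 * X$2) + lam * (X$4 * Y$2 - Y$4 * X$2)"
proof -
  have kappa: "2 * a x * deriv h (mu x $ 1) / h (mu x $ 1) = kappa x"
    by (simp add: a kappa_def h_mu_def dh_mu_def power2_eq_square power3_eq_cube)
  show ?thesis
    unfolding F wedge11_def kappa psi_def[symmetric] coords by (simp add: algebra_simps)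
qed

lemma FC_eq: "x \<in> M \<Longrightarrow> FC x X Y = of_real (kappa x) * (X$3 * Y$1 - Y$3 * X$1)
    + of_real (psi x * (lam - kappa x)) * (X$3 * Y$2 - Y$3 * X$2) + of_real lam * (X$4 * Y$2 - Y$4 * X$2)"
  by (simp add: FC_def cx_form_def F_eq complex_eq_iff algebra_simps)

lemma fst_vf: "x \<in> M \<Longrightarrow> fst (vf x) = vec4
    (of_real (- 1 + c * rho x * psi x / phi x)) (of_real (c * rho x / phi x))
    (- \<i> * of_real (rho x)) (\<i> * of_real (rho x * psi x))"
  by (simp add: vf_def J_x0 J2_x0 J3_x0 f_sq)
     (simp add: x0_eq gcx_def gscale_def vec4_eq_iff del_t_def axis_def)

lemma fst_vif: "x \<in> M \<Longrightarrow> fst (vif x) = vec4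
    (of_real (- 1 - c * rho x * psi x / phi x)) (of_real (- c * rho x / phi x))
    (- \<i> * of_real (rho x)) (\<i> * of_real (rho x * psi x))"
  by (simp add: vif_def J_x0 J2_x0 J3_x0 f_sq)
     (simp add: x0_eq gcx_def gscale_def vec4_eq_iff del_t_def axis_def)

text \<open>The value is \<open>- c \<rho> (\<kappa> + \<lambda> / f\<^sup>2)\<close>, which is zero by the choice of \<open>f\<close>.\<close>
lemma FC_vf_frame: assumes "x \<in> M" shows "FC x (fst (vf x)) (frame c x) = 0"
proof -
  have "H12 x = psi x * H22 x" using psi_H22[OF assms] by simp
  then show ?thesis
    using phi(1)[OF assms]
    by (simp add: FC_eq[OF assms] fst_vf[OF assms] frame_def complex_eq_iff field_simps)
       (use phi(3)[OF assms] in algebra)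
qed

text \<open>Passing from \<open>v\<^sub>f\<close> to \<open>v\<^sub>i\<^sub>f\<close> and from \<open>c\<close> to \<open>- c\<close> only reverses the sign of the value above.\<close>
lemma FC_vif_frame: assumes "x \<in> M" shows "FC x (fst (vif x)) (frame (- c) x) = 0"
proof -
  have "H12 x = psi x * H22 x" using psi_H22[OF assms] by simp
  then show ?thesis
    using phi(1)[OF assms]
    by (simp add: FC_eq[OF assms] fst_vif[OF assms] frame_def complex_eq_iff field_simps)
       (use phi(3)[OF assms] in algebra)
qed

lemma eps2_eq: "x \<in> M \<Longrightarrow> eps2 x X Y = - \<i> * (X$3 * Y$1 - X$1 * Y$3 + X$4 * Y$2 - X$2 * Y$4)"
  unfolding eps2_def eps_form_graph[OF L2_eq] by (simp add: ev_eq algebra_simps)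

lemma E1_eq: "x \<in> M \<Longrightarrow> E1 x = UNIV"
  by (force simp: E1_def L1_eq)

section \<open>Differentiating along Z\<close>

text \<open>The logarithm in \<open>\<alpha>\<close> splits into a function of \<open>\<mu>\<^sub>1\<close>, which has zero derivative along
  \<open>d\<mu>\<^sub>1 = 0\<close>, and \<open>- ln \<rho>\<close>.\<close>
lemma alpha_eq:
  assumes x: "x \<in> M" and X: "X $ 3 = 0"
  shows "alpha x X = cdiff rho x X / of_real (rho x)"
proof -
  \<comment> \<open>the factor 2 comes from \<open>G(X\<^sub>0, X\<^sub>0) = \<rho> / 2\<close>\<close>
  define w :: "real^4 \<Rightarrow> real" where "w y = ln (2 * (norm (phi y - 1) / phi y))" for y
  have phi': "phi differentiable at x" by (rule smooth_on_differentiable[OF smooth_phi x])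
  then have "(\<lambda>y. phi y - 1) differentiable at x" by simp
  moreover have "norm differentiable at (phi x - 1)"
    using phi(2)[OF x] by (intro differentiable_norm_at) simp
  ultimately have "(\<lambda>y. norm (phi y - 1)) differentiable at x"
    by (rule differentiable_compose[rotated])
  then have "(\<lambda>y. 2 * (norm (phi y - 1) / phi y)) differentiable at x"
    using phi' phi(1)[OF x] by (intro differentiable_mult differentiable_divide) auto
  moreover have "ln differentiable at (2 * (norm (phi x - 1) / phi x))"
  proof -
    have "2 * (norm (phi x - 1) / phi x) > 0" using phi[OF x] by simp
    from DERIV_ln[OF this] show ?thesis
      unfolding has_field_derivative_def differentiable_def by blast
  qed
  ultimately have "w differentiable at x"
    unfolding w_def[abs_def] by (rule differentiable_compose[rotated])
  then have w: "(w has_derivative frechet_derivative w (at x)) (at x)"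
    by (simp add: frechet_derivative_works)
  have w0: "frechet_derivative w (at x) V = 0" if "V $ 3 = 0" for V
    using that by (intro derivative_along_constant[OF w])
      (simp add: w_def phi_def kappa_def h_mu_def dh_mu_def)
  let ?D = "frechet_derivative rho (at x)"
  have r: "(rho has_derivative ?D) (at x)"
    by (rule smooth_on_has_derivative[OF smooth_rho x])
  have "((\<lambda>y. w y - ln (rho y)) has_derivative
      (\<lambda>V. frechet_derivative w (at x) V - ?D V * inverse (rho x))) (at x)"
    by (intro has_derivative_diff w has_derivative_ln rho_pos x r)
  then have "cdiff (\<lambda>y. w y - ln (rho y)) x X
      = - of_real (?D (vRe X) * inverse (rho x)) - \<i> * of_real (?D (vIm X) * inverse (rho x))"
    by (subst cdiff_eq) (auto simp: w0 X)
  also have "\<dots> = - cdiff rho x X / of_real (rho x)"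
    unfolding cdiff_eq[OF r] using rho_pos[OF x] by (simp add: field_simps)
  also have "cdiff (\<lambda>y. w y - ln (rho y)) x X
      = cdiff (\<lambda>q. ln (\<bar>(f q)\<^sup>2 - 1\<bar> / ((f q)\<^sup>2 * GX0 q))) x X"
  proof (rule cdiff_cong[OF M x])
    fix y assume y: "y \<in> M"
    have "ln (2 * (norm (phi y - 1) / phi y) / rho y) = w y - ln (rho y)"
      unfolding w_def using phi[OF y] rho_pos[OF y] by (intro ln_divide_pos) auto
    then show "w y - ln (rho y) = ln (\<bar>(f y)\<^sup>2 - 1\<bar> / ((f y)\<^sup>2 * GX0 y))"
      by (simp add: f_sq[OF y] GX0_eq[OF y] field_simps)
  qed
  finally show ?thesis by (simp add: alpha_def)
qed

text \<open>In \<open>Z = - c \<rho> (\<psi> \<partial>t\<^sub>1 + \<partial>t\<^sub>2)\<close> only \<open>\<rho>\<close> varies along \<open>X\<close>, and \<open>\<alpha>(X) = d\<rho>(X) / \<rho>\<close>.  So the derivative of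
  \<open>Z\<close> along \<open>X\<close> is \<open>\<alpha>(X) Z\<close> and cancels against the correction term.\<close>
lemma nablaZ_eq:
  assumes x: "x \<in> M" and X: "X x $ 3 = 0"
  shows "nablaZ X x = (\<chi> k. cdir (\<lambda>y. X y $ k) x (Z x))"
proof -
  let ?R = "frechet_derivative rho (at x)" and ?P = "frechet_derivative psi (at x)"
  have R: "(rho has_derivative ?R) (at x)" by (rule smooth_on_has_derivative[OF smooth_rho x])
  have P: "(psi has_derivative ?P) (at x)" by (rule smooth_on_has_derivative[OF smooth_psi x])
  have alpha: "alpha x (X x) * of_real (rho x) = of_real (?R (vRe (X x))) + \<i> * of_real (?R (vIm (X x)))"
    using rho_pos[OF x] by (simp add: alpha_eq[OF x X] cdiff_eq[OF R])
  have psi0: "?P (vRe (X x)) = 0" "?P (vIm (X x)) = 0"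
    using X by (simp_all add: psi_derivative[OF x])
  have "cdir (\<lambda>y. Z y $ k) x (X x) = alpha x (X x) * Z x $ k" for k
  proof -
    have 1: "cdir (\<lambda>y. Z y $ 1) x (X x) = alpha x (X x) * Z x $ 1"
    proof -
      have "((\<lambda>y. - c * (rho y * psi y)) has_derivative (\<lambda>V. - c * (rho x * ?P V + ?R V * psi x))) (at x)"
        by (intro has_derivative_mult_right has_derivative_mult R P)
      then have "cdiff (\<lambda>y. - c * (rho y * psi y)) x (X x) = alpha x (X x) * Z x $ 1"
        by (simp add: cdiff_eq psi0 Z_eq[OF x] alpha[symmetric] distrib_left)
           (use alpha in algebra)
      then show ?thesis
        unfolding cdiff_def by (subst cdir_cong[OF M x]) (auto simp: Z_eq)
    qed
    have 2: "cdir (\<lambda>y. Z y $ 2) x (X x) = alpha x (X x) * Z x $ 2"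
    proof -
      have "((\<lambda>y. - c * rho y) has_derivative (\<lambda>V. - c * ?R V)) (at x)"
        by (intro has_derivative_mult_right R)
      then have "cdiff (\<lambda>y. - c * rho y) x (X x) = alpha x (X x) * Z x $ 2"
        by (simp add: cdiff_eq Z_eq[OF x]) (use alpha in algebra)
      then show ?thesis
        unfolding cdiff_def by (subst cdir_cong[OF M x]) (auto simp: Z_eq)
    qed
    have 3: "cdir (\<lambda>y. Z y $ k) x (X x) = alpha x (X x) * Z x $ k" if "k = 3 \<or> k = 4"
      using that cdir_cong[OF M x, of "\<lambda>y. Z y $ k" "\<lambda>y. 0"] by (auto simp: Z_eq x)
    show ?thesis using 1 2 3 exhaust_4[of k] by auto
  qed
  then show ?thesis by (simp add: nablaZ_def lie_bracket_def vec_eq_iff)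
qed

lemma smooth_of_real: "smooth_on M \<phi> \<Longrightarrow> smooth_on M (\<lambda>x. complex_of_real (\<phi> x))"
  by (rule bounded_linear.smooth_on_image[OF bounded_linear_of_real M])

lemma smooth_frame: "smooth_on M (\<lambda>x. frame b x $ k)"
proof -
  have "smooth_on M (\<lambda>x. - \<i> * complex_of_real (H12 x + b))" "smooth_on M (\<lambda>x. - \<i> * complex_of_real (H22 x))"
    by (rule smooth_on_mult[OF M smooth_on_const smooth_of_real],
        (rule smooth_on_add[OF M smooth_entries(2) smooth_on_const] smooth_entries))+
  then show ?thesis using exhaust_4[of k] by (auto simp: frame_def smooth_on_const)
qed

lemma cdir_Z: "x \<in> M \<Longrightarrow> cdir \<phi> x (Z x) = frechet_derivative \<phi> (at x) (vec4 (- c * rho x * psi x) (- c * rho x) 0 0)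
    + \<i> * frechet_derivative \<phi> (at x) 0"
  unfolding cdir_def by (simp add: Z_eq)

lemma cdir_Z_frame: assumes "x \<in> M" shows "cdir (\<lambda>y. frame b y $ k) x (Z x) = 0"
proof -
  note frame = smooth_on_has_derivative[OF smooth_frame assms, of b k]
  have "frame b (x + t *\<^sub>R vec4 s s' 0 0) = frame b x" for s s' t
  proof -
    have "mu (x + t *\<^sub>R vec4 s s' 0 0) = mu x" by (simp add: mu_eq_iff)
    then show ?thesis by (simp add: frame_def H12_def H22_def)
  qed
  then show ?thesis
    using derivative_along_constant[OF frame] linear_0[OF has_derivative_linear[OF frame]]
    by (simp add: cdir_Z[OF assms])
qed

lemma smooth_cdir_Z:
  assumes "smooth_on M \<phi>" shows "smooth_on M (\<lambda>x. cdir \<phi> x (Z x))"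
proof (rule smooth_on_cong[OF M])
  let ?D = "\<lambda>v x. frechet_derivative \<phi> (at x) v"
  have D: "smooth_on M (?D v)" for v by (rule smooth_on_frechet_derivative[OF assms])
  show "smooth_on M (\<lambda>x. (- c * rho x * psi x) *\<^sub>R ?D (axis 1 1) x + (- c * rho x) *\<^sub>R ?D (axis 2 1) x)"
    by (rule smooth_on_add[OF M] smooth_on_scaleR[OF M _ D] smooth_on_mult[OF M]
        smooth_on_const smooth_rho smooth_psi)+
  fix x assume x: "x \<in> M"
  have lin: "linear (frechet_derivative \<phi> (at x))"
    by (rule has_derivative_linear[OF smooth_on_has_derivative[OF assms x]])
  have "vec4 (- c * rho x * psi x) (- c * rho x) 0 0
      = (- c * rho x * psi x) *\<^sub>R axis 1 1 + (- c * rho x) *\<^sub>R axis 2 (1::real)"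
    by (simp add: vec4_eq_iff axis_def)
  then show "(- c * rho x * psi x) *\<^sub>R ?D (axis 1 1) x + (- c * rho x) *\<^sub>R ?D (axis 2 1) x
      = cdir \<phi> x (Z x)"
    by (simp only: cdir_Z[OF x] linear_add[OF lin] linear_scale[OF lin] linear_0[OF lin]) simp
qed

text \<open>The frame depends on the momenta only, so \<open>Z\<close> differentiates just the coefficient.\<close>
lemma nablaZ_frame:
  assumes x: "x \<in> M" and X: "smooth_on M X" "\<And>y. y \<in> M \<Longrightarrow> X y = X y $ 4 *s frame b y"
  shows "nablaZ X x = cdir (\<lambda>y. X y $ 4) x (Z x) *s frame b x"
proof -
  have X3: "X x $ 3 = 0" by (subst X(2)[OF x]) (simp add: frame_def)
  have comp: "cdir (\<lambda>y. X y $ k) x (Z x) = cdir (\<lambda>y. X y $ 4) x (Z x) * frame b x $ k" for k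
  proof -
    have "X y $ k = X y $ 4 * frame b y $ k" if "y \<in> M" for y
      using arg_cong[OF X(2)[OF that], of "\<lambda>v. v $ k"] by simp
    then have "cdir (\<lambda>y. X y $ k) x (Z x) = cdir (\<lambda>y. X y $ 4 * frame b y $ k) x (Z x)"
      by (rule cdir_cong[OF M x])
    also have "\<dots> = cdir (\<lambda>y. X y $ 4) x (Z x) * frame b x $ k"
      using smooth_on_differentiable[OF smooth_on_component[OF M X(1)] x]
        smooth_on_differentiable[OF smooth_frame x]
      by (simp add: cdir_mult cdir_Z_frame[OF x])
    finally show ?thesis .
  qed
  show ?thesis
    unfolding nablaZ_eq[where X = X, OF x X3] vec_eq_iff vec_lambda_beta vector_smult_component
    by (intro allI comp)
qed

lemma FC_scale: "x \<in> M \<Longrightarrow> FC x U (s *s V) = s * FC x U V"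
  by (simp add: FC_eq algebra_simps)

lemma nablaZ_frame_section:
  assumes X: "X \<in> sections M T" and T: "\<And>x V. x \<in> M \<Longrightarrow> V \<in> T x \<longleftrightarrow> V = V $ 4 *s frame b x"
    and Y: "\<And>x. x \<in> M \<Longrightarrow> Y x = nablaZ X x"
  shows "Y \<in> sections M T"
proof -
  have smooth: "smooth_on M X" and X_frame: "\<And>y. y \<in> M \<Longrightarrow> X y = X y $ 4 *s frame b y"
    using X T by (auto simp: sections_def)
  have Y': "Y x = cdir (\<lambda>y. X y $ 4) x (Z x) *s frame b x" if "x \<in> M" for x
    using Y[OF that] nablaZ_frame[OF that smooth X_frame] by simp
  have "smooth_on M (\<lambda>x. cdir (\<lambda>y. X y $ 4) x (Z x) *s frame b x)"
    by (rule smooth_on_vecI[OF M])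
       (simp, rule smooth_on_mult[OF M smooth_cdir_Z[OF smooth_on_component[OF M smooth]] smooth_frame])
  then have "smooth_on M Y" by (rule smooth_on_cong[OF M, rotated]) (simp add: Y')
  moreover have "Y x \<in> T x" if "x \<in> M" for x
    using that by (simp add: T Y' frame_def)
  ultimately show ?thesis by (simp add: sections_def)
qed

section \<open>The conditions for the toric twist data\<close>

lemma KK1: "KK1"
  unfolding KK1_def
proof (intro ballI conjI)
  fix x X Y assume x: "x \<in> M"
  have FF: "FC x (s *s w) (t *s w) = 0" for s t w
    by (simp add: FC_eq[OF x] algebra_simps)
  show "X \<in> T12 x \<Longrightarrow> Y \<in> T12 x \<Longrightarrow> FC x X Y = 0"
    by (metis FF T12_iff[OF x])
  show "X \<in> T12bar x \<Longrightarrow> Y \<in> T12bar x \<Longrightarrow> FC x X Y = 0"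
    by (metis FF T12bar_iff[OF x])
qed (simp add: E1_eq)

lemma KK2: "KK2"
  unfolding KK2_def
proof (intro conjI ballI)
  fix X assume X: "X \<in> sections M T12"
  show "(\<lambda>p. nablaZ X p
        + (of_real ((f p)\<^sup>2) * FC p (fst (vf p)) (X p) / of_real (a p * ((f p)\<^sup>2 - 1))) *s vcx (X0 p))
      \<in> sections M T12"
  proof (rule nablaZ_frame_section[OF X T12_iff])
    fix x assume x: "x \<in> M"
    then have "X x \<in> T12 x" using X by (simp add: sections_def)
    then have X_frame: "X x = X x $ 4 *s frame c x" by (rule T12_iff[OF x, THEN iffD1])
    have "FC x (fst (vf x)) (X x $ 4 *s frame c x) = 0"
      by (simp add: FC_scale[OF x] FC_vf_frame[OF x])
    then have "FC x (fst (vf x)) (X x) = 0" by (simp only: X_frame[symmetric])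
    then show "nablaZ X x
        + (of_real ((f x)\<^sup>2) * FC x (fst (vf x)) (X x) / of_real (a x * ((f x)\<^sup>2 - 1))) *s vcx (X0 x)
        = nablaZ X x" by simp
  qed
next
  fix X assume X: "X \<in> sections M T12bar"
  show "(\<lambda>p. nablaZ X p
        - (of_real ((f p)\<^sup>2) * FC p (fst (vif p)) (X p) / of_real (a p * ((f p)\<^sup>2 - 1))) *s vcx (X0 p))
      \<in> sections M T12bar"
  proof (rule nablaZ_frame_section[OF X T12bar_iff])
    fix x assume x: "x \<in> M"
    then have "X x \<in> T12bar x" using X by (simp add: sections_def)
    then have X_frame: "X x = X x $ 4 *s frame (- c) x" by (rule T12bar_iff[OF x, THEN iffD1])
    have "FC x (fst (vif x)) (X x $ 4 *s frame (- c) x) = 0"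
      by (simp add: FC_scale[OF x] FC_vif_frame[OF x])
    then have "FC x (fst (vif x)) (X x) = 0" by (simp only: X_frame[symmetric])
    then show "nablaZ X x
        - (of_real ((f x)\<^sup>2) * FC x (fst (vif x)) (X x) / of_real (a x * ((f x)\<^sup>2 - 1))) *s vcx (X0 x)
        = nablaZ X x" by simp
  qed
qed

lemma a_eq: "a x = k0 / (h_mu x)\<^sup>2"
  by (simp add: a h_mu_def)

lemma kappa_eq: "2 * a x * dh_mu x / h_mu x = kappa x"
  by (simp add: a_eq kappa_def power2_eq_square power3_eq_cube)

lemma h_mu_fun: "(\<lambda>p. h (mu p $ 1)) = h_mu"
  by (simp add: h_mu_def[abs_def])

lemma h_mu_app: "h (mu x $ 1) = h_mu x"
  by (simp add: h_mu_def)

lemma cdiff_h_mu: "x \<in> M \<Longrightarrow> cdiff h_mu x X = of_real (dh_mu x) * X $ 3"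
  by (simp add: cdiff_eq[OF h_mu_has_derivative] complex_eq_iff)

lemma KK3: "KK3"
  unfolding KK3_def
proof (intro ballI)
  fix x V assume x: "x \<in> M" and "V \<in> fst ` S_perp x"
  then have V: "V $ 3 = 0" by (auto simp: S_perp_iff)
  have "frechet_derivative (\<lambda>q. a q * (f q)\<^sup>2 * (h (mu q $ 1))\<^sup>2) (at x) V
      = frechet_derivative (\<lambda>q. k0 * phi q) (at x) V"
    using h_nonzero
    by (intro fun_cong[OF frechet_derivative_cong_open[OF M x]]) (auto simp: f_sq a h_mu_def)
  also have "\<dots> = k0 * frechet_derivative phi (at x) V"
    by (intro frechet_derivative_eqI has_derivative_mult_right smooth_on_has_derivative[OF smooth_phi x])
  finally show "frechet_derivative (\<lambda>q. a q * (f q)\<^sup>2 * (h (mu q $ 1))\<^sup>2) (at x) V = 0"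
    by (simp add: derivative_zero_of_third[OF x V])
qed

lemma eps1_eq:
  assumes "x \<in> M"
  defines "S \<equiv> \<lambda>X. X $ 1 + \<i> * (of_real (H11 x) * X $ 3 + of_real (H12 x) * X $ 4)"
    and "S' \<equiv> \<lambda>X. X $ 2 + \<i> * (of_real (H12 x) * X $ 3 + of_real (H22 x) * X $ 4)"
  shows "eps1 x X Y = (S X * S' Y - S' X * S Y) / of_real c - of_real c * (X $ 3 * Y $ 4 - X $ 4 * Y $ 3)"
  using C(2) unfolding eps1_def eps_form_graph[OF L1_eq[OF assms(1)]] S_def S'_def
  by (simp add: ev_eq eps1_map_def Let_def field_simps)

text \<open>Here \<open>\<epsilon>\<^sub>1(X\<^sub>0, \<cdot>) = - (1/c) (dt\<^sub>2 + i (q d\<mu>\<^sub>1 + r d\<mu>\<^sub>2))\<close> and \<open>(2 a / h) dh = \<kappa> d\<mu>\<^sub>1\<close>.  After substituting these,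
  both sides of the first equation are polynomials in the components of the three vectors, and
  \<open>q = \<psi> r\<close> makes them equal.  In the second one \<open>dh\<close> vanishes on all arguments.\<close>
lemma KK4: "KK4"
  unfolding KK4_def unfolding h_mu_fun
proof (intro ballI conjI)
  fix x X Y W' assume x: "x \<in> M"
  define p q r \<psi> l \<kappa> n where defs: "p = complex_of_real (H11 x)" "q = complex_of_real (H12 x)"
    "r = complex_of_real (H22 x)" "\<psi> = complex_of_real (psi x)" "l = complex_of_real lam"
    "\<kappa> = complex_of_real (kappa x)" "n = 1 / complex_of_real c"
  have q: "q = \<psi> * r" by (simp add: defs flip: of_real_mult psi_H22[OF x])
  have eps: "eps1 x X Y = n * ((X $ 1 + \<i> * (p * X $ 3 + q * X $ 4)) * (Y $ 2 + \<i> * (q * Y $ 3 + r * Y $ 4))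
     - (X $ 2 + \<i> * (q * X $ 3 + r * X $ 4)) * (Y $ 1 + \<i> * (p * Y $ 3 + q * Y $ 4)))
     - of_real c * (X $ 3 * Y $ 4 - X $ 4 * Y $ 3)" for X Y
    by (simp add: eps1_eq[OF x] defs)
  have eps0: "eps1 x (vcx (X0 x)) Y = - n * (Y $ 2 + \<i> * (q * Y $ 3 + r * Y $ 4))" for Y
    unfolding eps by (simp add: X0 del_t_def axis_def algebra_simps)
  have FC: "FC x X Y = \<kappa> * (X$3 * Y$1 - Y$3 * X$1)
    + \<psi> * (l - \<kappa>) * (X$3 * Y$2 - Y$3 * X$2) + l * (X$4 * Y$2 - Y$4 * X$2)" for X Y
    by (simp add: FC_eq[OF x] defs)
  have \<kappa>: "of_real (2 * a x / h_mu x) * of_real (dh_mu x) = \<kappa>"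
    by (simp only: defs kappa_eq[symmetric] flip: of_real_mult) simp
  have ii: "\<i> * \<i> = - 1" by simp
  have "- of_real (2 * a x / h_mu x) * wedge21 (eps1 x) (cdiff h_mu x) X Y W'
      = - \<kappa> * (eps1 x X Y * W' $ 3 + eps1 x Y W' * X $ 3 + eps1 x W' X * Y $ 3)"
    unfolding wedge21_def cdiff_h_mu[OF x] \<kappa>[symmetric] by (simp add: algebra_simps)
  also have "\<dots> = wedge12 (eps1 x (vcx (X0 x))) (FC x) X Y W'"
    unfolding wedge12_def eps0 unfolding eps FC using q ii by algebra
  finally show "wedge12 (eps1 x (vcx (X0 x))) (FC x) X Y W'
      = - of_real (2 * a x / h (mu x $ 1)) * wedge21 (eps1 x) (cdiff h_mu x) X Y W'"
    unfolding h_mu_app by simp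
next
  fix x X Y W' assume x: "x \<in> M" "X \<in> T12 x" "Y \<in> T1bar2 x" "W' \<in> T2 x"
  have "X $ 3 = 0" "Y $ 3 = 0" "W' $ 3 = 0"
    using x by (auto simp: T12_def T1bar2_def T2_def S_perpC_iff)
  then show "wedge21 (eps2 x) (cdiff h_mu x) X Y W' = 0"
    by (simp add: wedge21_def cdiff_h_mu[OF x(1)])
qed

text \<open>The form \<open>\<epsilon>\<^sub>2\<close> has constant coefficients and the operator differentiates the components along
  \<open>Z\<close>, so this is the Leibniz rule.\<close>
lemma Deps2_zero:
  assumes X: "X \<in> sections M T2" and Y: "Y \<in> sections M T2" and x: "x \<in> M"
  shows "Deps2 X Y x = 0"
proof -
  have 3: "X y $ 3 = 0" "Y y $ 3 = 0" if "y \<in> M" for y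
    using X Y that by (auto simp: sections_def T2_third)
  have diff: "(\<lambda>y. X y $ k) differentiable at x" "(\<lambda>y. Y y $ k) differentiable at x" for k
    using X Y smooth_on_differentiable[OF smooth_on_component[OF M] x] by (auto simp: sections_def)
  have "cdir (\<lambda>q. eps2 q (X q) (Y q)) x (Z x)
      = cdir (\<lambda>q. - \<i> * (X q $ 3 * Y q $ 1 - X q $ 1 * Y q $ 3 + X q $ 4 * Y q $ 2 - X q $ 2 * Y q $ 4)) x (Z x)"
    by (rule cdir_cong[OF M x]) (simp add: eps2_eq)
  also have "\<dots> = eps2 x (nablaZ X x) (Y x) + eps2 x (X x) (nablaZ Y x)"
    unfolding nablaZ_eq[where X = X, OF x 3(1)[OF x]] nablaZ_eq[where X = Y, OF x 3(2)[OF x]] eps2_eq[OF x]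
    by (simp add: cdir_mult cdir_diff cdir_add diff algebra_simps)
  finally show ?thesis by (simp add: Deps2_def)
qed

text \<open>The one-form is \<open>2 (1 / f\<^sup>2 - 1) (dt\<^sub>1 - \<psi> dt\<^sub>2)\<close>, because \<open>G(X\<^sub>0, X\<^sub>0) = \<rho> / 2\<close> cancels the factor \<open>\<rho>\<close> of
  the covector part of \<open>J\<^sub>3 X\<^sub>0\<close>.\<close>
lemma primitive_derivative_zero:
  assumes x: "x \<in> M" and V: "V $ 3 = 0"
  shows "frechet_derivative (\<lambda>q. ((1 - (f q)\<^sup>2) / ((f q)\<^sup>2 * GX0 q)) *\<^sub>R snd (J3 q (x0 q))) (at x) V = 0"
proof -
  define u :: "real^4 \<Rightarrow> real" where "u = (\<lambda>q. 2 * (1 - phi q) / phi q)"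
  have "smooth_on M u"
    unfolding u_def using phi(1)
    by (intro smooth_on_divide[OF M] smooth_on_mult[OF M] smooth_on_const smooth_on_diff[OF M] smooth_phi) fastforce
  from smooth_on_has_derivative[OF this x]
  have u: "(u has_derivative frechet_derivative u (at x)) (at x)" .
  have u0: "frechet_derivative u (at x) V = 0"
    by (rule derivative_along_constant[OF u]) (simp add: V u_def phi_def kappa_def h_mu_def dh_mu_def)
  have p: "(psi has_derivative frechet_derivative psi (at x)) (at x)"
    by (rule smooth_on_has_derivative[OF smooth_psi x])
  have "frechet_derivative (\<lambda>q. ((1 - (f q)\<^sup>2) / ((f q)\<^sup>2 * GX0 q)) *\<^sub>R snd (J3 q (x0 q))) (at x) V
      = frechet_derivative (\<lambda>q. u q *\<^sub>R (axis 1 1 - psi q *\<^sub>R axis 2 1)) (at x) V"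
  proof (rule fun_cong[OF frechet_derivative_cong_open[OF M x]])
    fix y assume y: "y \<in> M"
    show "((1 - (f y)\<^sup>2) / ((f y)\<^sup>2 * GX0 y)) *\<^sub>R snd (J3 y (x0 y)) = u y *\<^sub>R (axis 1 1 - psi y *\<^sub>R axis 2 1)"
      using rho_pos[OF y] phi(1)[OF y]
      by (simp add: f_sq[OF y] GX0_eq[OF y] J3_x0[OF y] u_def vec4_eq_iff axis_def field_simps)
  qed
  also have "\<dots> = u x *\<^sub>R (0 - frechet_derivative psi (at x) V *\<^sub>R axis 2 1)
      + frechet_derivative u (at x) V *\<^sub>R (axis 1 1 - psi x *\<^sub>R axis 2 1)"
    by (intro frechet_derivative_eqI has_derivative_scaleR has_derivative_diff has_derivative_const
        has_derivative_scaleR_left u p)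
  finally show ?thesis using u0 psi_derivative[OF x V] by simp
qed

text \<open>The first two terms of the left-hand side and the wedge product with \<open>dh\<close> vanish.  The rest is a
  multiple of \<open>d\<mu>\<^sub>2 \<and> dt\<^sub>2\<close> on either side; the coefficients agree by \<open>\<lambda> = - \<kappa> f\<^sup>2\<close>.\<close>
lemma KK5: "KK5"
  unfolding KK5_def unfolding h_mu_fun
proof (intro ballI)
  fix X Y x assume X: "X \<in> sections M T2" and Y: "Y \<in> sections M T2" and x: "x \<in> M"
  have 3: "X x $ 3 = 0" "Y x $ 3 = 0"
    using X Y x by (auto simp: sections_def T2_third)
  let ?w = "X x $ 4 * Y x $ 2 - X x $ 2 * Y x $ 4"
  have 1: "cx_form (ext_deriv1
        (\<lambda>q. ((1 - (f q)\<^sup>2) / ((f q)\<^sup>2 * GX0 q)) *\<^sub>R snd (J3 q (x0 q))) x) (X x) (Y x) = 0"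
    unfolding cx_form_def ext_deriv1_def
    by (simp add: primitive_derivative_zero[OF x] 3 ev_eq)
  have "2 / (a x * phi x) * lam = - 2 * kappa x / a x"
    by (subst phi(3)[OF x]) (use phi(1)[OF x] in simp)
  also have "\<dots> = - (2 / (h_mu x * (rho x / 2)) * (dh_mu x * rho x))"
    using rho_pos[OF x] h_nonzero[OF x] nonzero unfolding kappa_eq[symmetric] a_eq by simp
  finally have coeff: "complex_of_real (2 / (a x * phi x)) * of_real lam
      = - (of_real (2 / (h_mu x * (rho x / 2))) * (of_real (dh_mu x) * of_real (rho x)))"
    by (simp only: flip: of_real_mult of_real_minus)
  have ii: "\<i> * \<i> = - 1" by simp
  have "of_real (2 / (a x * (f x)\<^sup>2)) * FC x (X x) (Y x)
      = complex_of_real (2 / (a x * phi x)) * of_real lam * ?w"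
    by (simp add: FC_eq[OF x] f_sq[OF x] 3 algebra_simps)
  also have "\<dots> = of_real (2 / (h_mu x * (rho x / 2))) * ((of_real (dh_mu x) * (- \<i> * of_real (rho x))) * (- \<i> * ?w))"
    unfolding coeff using ii by algebra
  also have "\<dots> = of_real (2 / (h_mu x * GX0 x)) *
      (cdiff h_mu x (fst (vf x)) * eps2 x (X x) (Y x)
        + wedge11 (ev (snd (vf x))) (cdiff h_mu x) (X x) (Y x))"
    by (simp add: wedge11_def cdiff_h_mu[OF x] fst_vf[OF x] eps2_eq[OF x] GX0_eq[OF x] 3)
  finally show "cx_form (ext_deriv1
        (\<lambda>q. ((1 - (f q)\<^sup>2) / ((f q)\<^sup>2 * GX0 q)) *\<^sub>R snd (J3 q (x0 q))) x) (X x) (Y x)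
      + of_real (((f x)\<^sup>2 - 1) / ((f x)\<^sup>2 * GX0 x)) * Deps2 X Y x
      + of_real (2 / (a x * (f x)\<^sup>2)) * FC x (X x) (Y x)
    = of_real (2 / (h (mu x $ 1) * GX0 x)) *
      (cdiff h_mu x (fst (vf x)) * eps2 x (X x) (Y x)
        + wedge11 (ev (snd (vf x))) (cdiff h_mu x) (X x) (Y x))"
    unfolding h_mu_app 1 Deps2_zero[OF X Y x] by simp
qed

lemma a_has_derivative:
  assumes x: "x \<in> M" shows "(a has_derivative (\<lambda>V. - F x (X0 x) V)) (at x)"
proof -
  have "(a has_derivative (\<lambda>V. - k0 * (2 * (dh_mu x * V $ 3) * h_mu x) / (h_mu x ^ 2 * h_mu x ^ 2))) (at x)"
    unfolding a_eq[abs_def] using h_nonzero(1)[OF x]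
    by (auto intro!: derivative_eq_intros h_mu_has_derivative[OF x] simp: power2_eq_square field_simps)
  moreover have "- k0 * (2 * (dh_mu x * V $ 3) * h_mu x) / (h_mu x ^ 2 * h_mu x ^ 2) = - F x (X0 x) V" for V
    using h_nonzero(1)[OF x]
    by (simp add: F_eq[OF x] X0 del_t_def axis_def kappa_def power2_eq_square power3_eq_cube mult_ac)
  ultimately show ?thesis by simp
qed

text \<open>Both non-constant coefficients of \<open>F\<close> have differentials that are multiples of \<open>d\<mu>\<^sub>1\<close>, and each of
  them multiplies a form with a factor \<open>d\<mu>\<^sub>1\<close>.\<close>
lemma closed: "closed_form2 M F"
proof -
  define b where "b y = psi y * (lam - kappa y)" for y
  have smooth_b: "smooth_on M b"
    unfolding b_def[abs_def]
    by (rule smooth_on_mult[OF M smooth_psi smooth_on_diff[OF M smooth_on_const smooth_kappa]])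
  have F_form: "F y Y Z = kappa y * (Y$3 * Z$1 - Z$3 * Y$1) + b y * (Y$3 * Z$2 - Z$3 * Y$2)
      + lam * (Y$4 * Z$2 - Z$4 * Y$2)" if "y \<in> M" for y Y Z
    by (simp add: F_eq[OF that] b_def)
  have "smooth_on M (\<lambda>y. F y Y Z)" for Y Z
  proof (rule smooth_on_cong[OF M])
    show "smooth_on M (\<lambda>y. kappa y * (Y$3 * Z$1 - Z$3 * Y$1) + b y * (Y$3 * Z$2 - Z$3 * Y$2)
      + lam * (Y$4 * Z$2 - Z$4 * Y$2))"
      by (rule smooth_on_add[OF M] smooth_on_mult[OF M _ smooth_on_const] smooth_kappa smooth_b smooth_on_const)+
  qed (simp add: F_form)
  moreover have "ext_deriv2 F x X Y Z = 0" if x: "x \<in> M" for x X Y Z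
  proof -
    let ?K = "frechet_derivative kappa (at x)" and ?B = "frechet_derivative b (at x)"
    have K: "(kappa has_derivative ?K) (at x)" by (rule smooth_on_has_derivative[OF smooth_kappa x])
    have B: "(b has_derivative ?B) (at x)" by (rule smooth_on_has_derivative[OF smooth_b x])
    have B0: "?B V = 0" if "V $ 3 = 0" for V
    proof -
      have "(b has_derivative (\<lambda>V. psi x * (0 - ?K V)
          + frechet_derivative psi (at x) V * (lam - kappa x))) (at x)"
        unfolding b_def[abs_def]
        by (intro has_derivative_mult has_derivative_diff has_derivative_const K
            smooth_on_has_derivative[OF smooth_psi x])
      then show ?thesis
        using derivative_zero_of_third(2)[OF x that] psi_derivative[OF x that]
        by (simp add: frechet_derivative_eqI)
    qed
    define \<kappa> \<beta> where "\<kappa> = ?K (axis 3 1)" and "\<beta> = ?B (axis 3 1)"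
    have dF: "frechet_derivative (\<lambda>y. F y Y Z) (at x) X
        = X $ 3 * \<kappa> * (Y$3 * Z$1 - Z$3 * Y$1) + X $ 3 * \<beta> * (Y$3 * Z$2 - Z$3 * Y$2)" for X Y Z
    proof -
      have "((\<lambda>y. kappa y * (Y$3 * Z$1 - Z$3 * Y$1) + b y * (Y$3 * Z$2 - Z$3 * Y$2)
          + lam * (Y$4 * Z$2 - Z$4 * Y$2)) has_derivative
          (\<lambda>X. ?K X * (Y$3 * Z$1 - Z$3 * Y$1) + ?B X * (Y$3 * Z$2 - Z$3 * Y$2) + 0)) (at x)"
        by (intro has_derivative_add has_derivative_mult_left has_derivative_const K B)
      from frechet_derivative_eqI[OF this, of X]
      have "frechet_derivative (\<lambda>y. F y Y Z) (at x) X
          = ?K X * (Y$3 * Z$1 - Z$3 * Y$1) + ?B X * (Y$3 * Z$2 - Z$3 * Y$2)"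
        by (subst frechet_derivative_cong_open[OF M x F_form]) auto
      then show ?thesis
        using derivative_third[OF K derivative_zero_of_third(2)[OF x], of X] derivative_third[OF B B0, of X]
        by (simp add: \<kappa>_def \<beta>_def)
    qed
    show ?thesis unfolding ext_deriv2_def dF by (simp add: algebra_simps)
  qed
  ultimately show ?thesis by (simp add: closed_form2_def)
qed

text \<open>Every local flow of \<open>X\<^sub>0\<close> is a translation along \<open>t\<^sub>1\<close>, since \<open>\<phi>\<^sub>s(y) - s X\<^sub>0\<close> is constant on the time
  interval; and the coefficients of \<open>F\<close> depend on the momenta only.\<close>
lemma invariant: "flow_invariant2 M X0 F"
  unfolding flow_invariant2_def
proof (intro allI impI ballI)
  fix T V \<phi> s x Y Z
  assume flow: "local_flow M X0 T V \<phi>" and s: "s \<in> T" and x: "x \<in> V"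
  have shift: "\<phi> s y = y + s *\<^sub>R X0 0" if y: "y \<in> V" for y
  proof -
    define g where "g = (\<lambda>s. \<phi> s y - s *\<^sub>R X0 0)"
    have "convex T" using flow by (simp add: local_flow_def is_interval_convex)
    moreover have "(g has_vector_derivative 0) (at s within T)" if "s \<in> T" for s
    proof -
      have "((\<lambda>s. \<phi> s y) has_vector_derivative X0 0) (at s within T)"
        using flow y that by (auto simp: local_flow_def X0 intro: has_vector_derivative_at_within)
      then show ?thesis
        unfolding g_def by (auto intro!: derivative_eq_intros)
    qed
    ultimately obtain k where "\<And>s. s \<in> T \<Longrightarrow> g s = k"
      using has_vector_derivative_zero_constant by blast
    then have "g s = g 0" using s flow by (auto simp: local_flow_def)
    then show ?thesis using flow y by (simp add: g_def local_flow_def algebra_simps)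
  qed
  have "open V" using flow by (simp add: local_flow_def)
  then have D: "frechet_derivative (\<phi> s) (at x) = frechet_derivative (\<lambda>y. y + s *\<^sub>R X0 0) (at x)"
    by (rule frechet_derivative_cong_open[OF _ x shift])
  have "((\<lambda>y. y + s *\<^sub>R X0 0) has_derivative (\<lambda>v. v)) (at x)"
    by (auto intro!: derivative_eq_intros)
  then have D: "frechet_derivative (\<phi> s) (at x) v = v" for v
    unfolding D by (rule frechet_derivative_eqI)
  have "mu (\<phi> s x) = mu x"
    by (simp add: shift[OF x] mu_eq_iff X0 del_t_def axis_def)
  then show "F (\<phi> s x) (frechet_derivative (\<phi> s) (at x) Y) (frechet_derivative (\<phi> s) (at x) Z) = F x Y Z"
    unfolding D F a by simp
qed

end

theorem corollary50:
  fixes M :: "(real^4) set"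
    and \<tau> :: "real^2 \<Rightarrow> real" and C :: "real^2^2"
    and Gend J :: "real^4 \<Rightarrow> gtan \<Rightarrow> gtan"
    and h :: "real \<Rightarrow> real" and lam k0 :: real
    and X0 :: "real^4 \<Rightarrow> real^4"
    and F :: "real^4 \<Rightarrow> real^4 \<Rightarrow> real^4 \<Rightarrow> real"
    and f a :: "real^4 \<Rightarrow> real"
  assumes M: "open M" "connected M"
    and tau: "smooth_on (mu ` M) \<tau>"
      "\<forall>m \<in> mu ` M. \<forall>v. v \<noteq> 0 \<longrightarrow> v \<bullet> (hessian \<tau> m *v v) > 0"
    and C: "transpose C = - C" "C $ 1 $ 2 \<noteq> 0"
    and GJ: "\<forall>p\<in>M. toric_structure (Psi \<tau> C (mu p)) (Gend p) (J p)"
    and Psi: "\<forall>m \<in> mu ` M. partial_deriv 2 (\<lambda>m. Psi12s \<tau> C m / Psi \<tau> C m $ 2 $ 2) m = 0"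
    and h: "smooth_on ((\<lambda>p. mu p $ 1) ` M) h"
      "\<forall>x \<in> (\<lambda>p. mu p $ 1) ` M. h x \<noteq> 0 \<and> deriv h x \<noteq> 0"
    and nonzero: "lam \<noteq> 0" "k0 \<noteq> 0"
    and ratio: "\<forall>x \<in> (\<lambda>p. mu p $ 1) ` M.
      lam * h x ^ 3 / (k0 * deriv h x) < 0 \<and> lam * h x ^ 3 / (k0 * deriv h x) \<noteq> -2"
    and X0: "X0 = (\<lambda>p. - del_t 1)"
    and a: "a = (\<lambda>p. k0 / (h (mu p $ 1))\<^sup>2)"
    and f: "\<forall>p\<in>M. (f p)\<^sup>2 = - (lam * h (mu p $ 1) ^ 3 / (2 * k0 * deriv h (mu p $ 1)))"
    and F: "F = (\<lambda>p X Y.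
      2 * a p * deriv h (mu p $ 1) / h (mu p $ 1) * wedge11 (dmu 1) (dt 1) X Y
      + wedge11 (\<lambda>V. Psi12s \<tau> C (mu p) / Psi \<tau> C (mu p) $ 2 $ 2
              * (lam - 2 * a p * deriv h (mu p $ 1) / h (mu p $ 1)) * dmu 1 V
            + lam * dmu 2 V) (dt 2) X Y)"
  shows "closed_form2 M F \<and>
    flow_invariant2 M X0 F \<and>
    (\<forall>p\<in>M. (a has_derivative (\<lambda>V. - F p (X0 p) V)) (at p)) \<and>
    twist_data.KK1 M Gend J X0 F \<and>
    twist_data.KK2 M Gend J X0 F f a \<and>
    twist_data.KK3 M Gend J X0 f a (\<lambda>p. h (mu p $ 1)) \<and>
    twist_data.KK4 M Gend J X0 F a (\<lambda>p. h (mu p $ 1)) \<and>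
    twist_data.KK5 M Gend J X0 F f a (\<lambda>p. h (mu p $ 1))"
proof -
  interpret toric_twist M \<tau> C Gend J h lam k0 X0 F f a
    using assms by unfold_locales
  show ?thesis
    using closed invariant a_has_derivative KK1 KK2 KK3 KK4 KK5 by blast
qed

end
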